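(* There is a sequence $c_n\to0$ ($c_n\in(0,1)$) such that for any estimator $\hat f_n$ based on the $n$ observations $(X_\lambda)_{\lambda\in\Lambda}$, as $n\to\infty$, $$\sup_{f\in\mathcal F_0(\gamma_n)}\mathbf E_f\big[\|\hat f_n-f\|^2\big]\ge\sup_{\alpha_n\in S_\Lambda(n\gamma_n,c_n)}2\,(1+o(1))\Big(\sum_{\lambda\in\Lambda}\sigma_\lambda^2\,\alpha_{\lambda,n}\log(\alpha_{\lambda,n}^{-1})\Big),$$ where $S_\Lambda(R,c)=\{\alpha\in[0,c]^\Lambda\mid\sum_{\lambda}\alpha_\lambda\le R(1-c)\}$. Moreover, for integers $1\le r_n\le n$ with $\log(n/r_n)=o(\log(\gamma_n^{-1}))$, one has, as $n\to\infty$, $$\sup_{f\in\mathcal F_0(\gamma_n)}\mathbf E_f\big[\|\hat f_n-f\|^2\big]\ge2n\gamma_n\log(\gamma_n^{-1})\,(1+o(1))\,\frac1{r_n}\sum_{i=1}^{r_n}\sigma_{(i)}^2 .$$ In the case of polynomial growth $\sigma_{(i)}^2\sim(n-i)^\beta$ with some $\beta>0$, one has, as $n\to\infty$, $$\sup_{f\in\mathcal F_0(\gamma_n)}\mathbf E_f\big[\|\hat f_n-f\|^2\big]\ge2\,(1+o(1))\,\|\Sigma\|\,n\gamma_n\log(\gamma_n^{-1}).$$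
   Context: For each $n$, let $\Lambda=\Lambda_n$ be a finite index set with $\#\Lambda=n$. One observes $X_\lambda=f_\lambda+\xi_\lambda$, $\lambda\in\Lambda$, where $f=(f_\lambda)\in\mathbb R^\Lambda$ is unknown and $(\xi_\lambda)_{\lambda\in\Lambda}\sim\mathcal N(0,\Sigma)$ with $\Sigma=\mathrm{diag}(\sigma_\lambda^2)_{\lambda\in\Lambda}$, $\sigma_\lambda>0$ (the $\sigma_\lambda$ may depend on $n$). $\|\Sigma\|=\max_\lambda\sigma_\lambda^2$; $\sigma_{(1)}^2\ge\sigma_{(2)}^2\ge\dots\ge\sigma_{(n)}^2$ are the values $(\sigma_\lambda^2)_{\lambda\in\Lambda}$ in decreasing order (inverse order statistics). $\mathbf E_f$ is expectation when the true parameter is $f$. An estimator is a measurable function of $(X_\lambda)_{\lambda\in\Lambda}$ with values in $\mathbb R^\Lambda$, and $\|\hat f_n-f\|^2=\sum_{\lambda\in\Lambda}(\hat f_{n,\lambda}-f_\lambda)^2$. Sparsity class: $\mathcal F_0(\gamma_n)=\{f:\sum_{\lambda\in\Lambda}\mathbf 1(f_\lambda\ne0)\le n\gamma_n\}$, where $\gamma_n\in(0,1)$ satisfies $\gamma_n\to0$ and $n\gamma_n\to\infty$ as $n\to\infty$. Conventions: $0\log(0^{-1})=0$. The $o(1)$ terms tend to $0$ as $n\to\infty$ and do not depend on the estimator $\hat f_n$ or on $\alpha_n$. The notation $\sigma_{(i)}^2\sim(n-i)^\beta$ means $\sigma_{(i)}^2/(n-i)^\beta\to1$ as $n-i\to\infty$,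 i.e. for every $\varepsilon>0$ there is $M$ with $|\sigma_{(i)}^2/(n-i)^\beta-1|\le\varepsilon$ whenever $n-i\ge M$, $1\le i\le n$. *)

theory Defs
  imports "HOL-Probability.Probability" "HOL-Library.Landau_Symbols"
begin

text \<open>
  The heteroscedastic Gaussian sequence model over a finite index set \<open>\<Lambda>\<close>. Elements of
  \<open>\<real>\<^sup>\<Lambda>\<close> are extensional functions, i.e. members of \<open>\<Lambda> \<rightarrow>\<^sub>E UNIV\<close>. Since the covariance matrix
  is diagonal, the noise law \<open>N(0, diag (\<sigma>\<^sup>2))\<close> is the product of the laws \<open>N(0, (\<sigma> l)\<^sup>2)\<close>.
  Note that \<open>normal_density\<close> takes the standard deviation, not the variance.
\<close>

definition noise_law :: "'i set \<Rightarrow> ('i \<Rightarrow> real) \<Rightarrow> ('i \<Rightarrow> real) measure" where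
  "noise_law \<Lambda> \<sigma> = PiM \<Lambda> (\<lambda>l. density lborel (\<lambda>x. ennreal (normal_density 0 (\<sigma> l) x)))"

definition obs_law :: "'i set \<Rightarrow> ('i \<Rightarrow> real) \<Rightarrow> ('i \<Rightarrow> real) \<Rightarrow> ('i \<Rightarrow> real) measure" where
  "obs_law \<Lambda> \<sigma> f = distr (noise_law \<Lambda> \<sigma>) (PiM \<Lambda> (\<lambda>_. borel)) (\<lambda>\<xi>. \<lambda>l\<in>\<Lambda>. f l + \<xi> l)"

definition estimators :: "'i set \<Rightarrow> (('i \<Rightarrow> real) \<Rightarrow> 'i \<Rightarrow> real) set" where
  "estimators \<Lambda> = measurable (PiM \<Lambda> (\<lambda>_. borel)) (PiM \<Lambda> (\<lambda>_. borel))"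

text \<open>The risk is an \<open>ennreal\<close>, so that estimators of infinite risk get the value \<open>\<infinity>\<close>.\<close>

definition risk ::
  "'i set \<Rightarrow> ('i \<Rightarrow> real) \<Rightarrow> (('i \<Rightarrow> real) \<Rightarrow> 'i \<Rightarrow> real) \<Rightarrow> ('i \<Rightarrow> real) \<Rightarrow> ennreal" where
  "risk \<Lambda> \<sigma> fhat f = (\<integral>\<^sup>+ X. ennreal (\<Sum>l\<in>\<Lambda>. (fhat X l - f l)\<^sup>2) \<partial>obs_law \<Lambda> \<sigma> f)"

definition sparse_class :: "'i set \<Rightarrow> real \<Rightarrow> ('i \<Rightarrow> real) set" where
  "sparse_class \<Lambda> \<gamma> =
     {f \<in> \<Lambda> \<rightarrow>\<^sub>E UNIV. (\<Sum>l\<in>\<Lambda>. of_bool (f l \<noteq> 0)) \<le> real (card \<Lambda>) * \<gamma>}"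

definition max_risk ::
  "'i set \<Rightarrow> ('i \<Rightarrow> real) \<Rightarrow> real \<Rightarrow> (('i \<Rightarrow> real) \<Rightarrow> 'i \<Rightarrow> real) \<Rightarrow> ennreal" where
  "max_risk \<Lambda> \<sigma> \<gamma> fhat = (SUP f\<in>sparse_class \<Lambda> \<gamma>. risk \<Lambda> \<sigma> fhat f)"

definition weight_set :: "'i set \<Rightarrow> real \<Rightarrow> real \<Rightarrow> ('i \<Rightarrow> real) set" where
  "weight_set \<Lambda> R c = {\<alpha> \<in> \<Lambda> \<rightarrow>\<^sub>E {0..c}. (\<Sum>l\<in>\<Lambda>. \<alpha> l) \<le> R * (1 - c)}"

text \<open>
  The \<open>i\<close>-th largest variance, with multiplicity; it is meaningful for \<open>1 \<le> i \<le> card \<Lambda>\<close>.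
\<close>

definition var_desc :: "'i set \<Rightarrow> ('i \<Rightarrow> real) \<Rightarrow> nat \<Rightarrow> real" where
  "var_desc \<Lambda> \<sigma> i =
     rev (sorted_list_of_multiset (image_mset (\<lambda>l. (\<sigma> l)\<^sup>2) (mset_set \<Lambda>))) ! (i - 1)"

definition max_var :: "'i set \<Rightarrow> ('i \<Rightarrow> real) \<Rightarrow> real" where
  "max_var \<Lambda> \<sigma> = (MAX l\<in>\<Lambda>. (\<sigma> l)\<^sup>2)"

text \<open>\<open>\<sigma>\<^bsub>(i)\<^esub>\<^sup>2 \<sim> (n - i)\<^sup>\<beta>\<close> as \<open>n - i \<rightarrow> \<infinity>\<close>, uniformly in \<open>n\<close> and \<open>i\<close>.\<close>

definition poly_growth :: "(nat \<Rightarrow> 'i set) \<Rightarrow> (nat \<Rightarrow> 'i \<Rightarrow> real) \<Rightarrow> real \<Rightarrow> bool" where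
  "poly_growth \<Lambda> \<sigma> \<beta> \<longleftrightarrow>
     (\<forall>\<epsilon>>0. \<exists>M. \<forall>n i. 1 \<le> i \<and> i \<le> n \<and> M \<le> n - i \<longrightarrow>
        \<bar>var_desc (\<Lambda> n) (\<sigma> n) i / real (n - i) powr \<beta> - 1\<bar> \<le> \<epsilon>)"

end

theory Submission
  imports Defs "HOL-Real_Asymp.Real_Asymp"
begin

text \<open>
The minimax risk is bounded below by the average risk under a prior. Each coordinate \<open>l\<close> is
independently a spike of height \<open>m l\<close> with probability \<open>\<alpha> l\<close>, and zero otherwise.

In one coordinate, with unit noise and spike height \<open>\<mu>\<close>, the observation is at most \<open>\<mu> + t\<close> with
probability close to one when the spike is present, for \<open>t\<close> large. On that event
the likelihood ratio of spike against zero is at most \<open>exp (\<mu>\<^sup>2 / 2 + \<mu> * t)\<close>. If \<open>\<mu>\<close> is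
slightly below \<open>sqrt (2 * ln (1 / \<alpha>))\<close>, the product of this ratio with the prior odds, about \<open>\<alpha>\<close>,
is still small, so even the Bayes estimator answers nearly zero and pays nearly \<open>\<mu>\<^sup>2\<close>
when the spike is present. The coordinate therefore
costs about \<open>\<alpha> * \<mu>\<^sup>2\<close>, that is \<open>2 * \<alpha> * ln (1 / \<alpha>)\<close>, as \<open>\<alpha>\<close> tends to zero
(\<open>two_point_risk\<close>, \<open>spike_risk_bound_exists\<close>), times the variance by scaling.

The prior does not live on the sparsity class: with \<open>R\<close> the sparsity level \<open>n * \<gamma> n\<close>, the number of
spikes may exceed \<open>R\<close>. Only the draws with at most \<open>R\<close> spikes may be kept, and conditioning on them would make the
coordinates dependent. The remedy works one coordinate at a time. When coordinate \<open>l\<close> is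
considered, only those draws are kept in which the \<^emph>\<open>other\<close> coordinates carry at most \<open>R - 1\<close>
spikes. This event is independent of the presence of a spike at \<open>l\<close>, and it implies the
sparsity constraint. Given the other coordinates, the \<open>l\<close>-th component of any estimator is
an ordinary estimator in the one-dimensional two-point problem, so the one-dimensional bound
applies after Fubini (\<open>coord_risk_two_point\<close>, \<open>truncated_Bayes_coord_risk\<close>). The event has
probability tending to one by Chebyshev's inequality, because the expected number of spikes is at
most \<open>R * (1 - c)\<close> and \<open>R\<close> tends to infinity (\<open>subset_prob_card_le\<close>). Summing over \<open>l\<close> gives the
first bound for each fixed \<open>c\<close> and a factor \<open>1 - \<epsilon>\<close> (\<open>max_risk_ge_weight_set\<close>); a diagonal
argument lets both \<open>c\<close> and \<open>\<epsilon>\<close> tend to zero.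

The second bound is obtained from equal weights \<open>n * \<gamma> n * (1 - c) / r n\<close> on the \<open>r n\<close>
coordinates of largest variance. The condition on \<open>r\<close> makes the logarithm of the inverse
weight equivalent to \<open>ln (1 / \<gamma> n)\<close>. Under polynomial growth, the largest \<open>\<eta> * n\<close> variances are all
close to the maximum when \<open>\<eta>\<close> is small, so the third bound follows from the second with
\<open>r n = \<lceil>\<eta> * n\<rceil>\<close>.
\<close>

section \<open>The number of spikes\<close>

text \<open>
The law of the random subset of \<open>A\<close> that contains each \<open>l\<close> independently with probability
\<open>\<alpha> l\<close>. Since \<open>A\<close> is finite, expectations are sums over \<open>Pow A\<close>, which can be
split at one coordinate by \<open>Pow_insert\<close>.
\<close>

definition subset_prob :: "'i set \<Rightarrow> ('i \<Rightarrow> real) \<Rightarrow> 'i set \<Rightarrow> real" where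
  "subset_prob A \<alpha> S = (\<Prod>l\<in>S. \<alpha> l) * (\<Prod>l\<in>A - S. 1 - \<alpha> l)"

lemma subset_prob_insert:
  assumes "finite A" "x \<notin> A" "T \<subseteq> A"
  shows "subset_prob (insert x A) \<alpha> T = (1 - \<alpha> x) * subset_prob A \<alpha> T"
    and "subset_prob (insert x A) \<alpha> (insert x T) = \<alpha> x * subset_prob A \<alpha> T"
proof -
  have "insert x A - T = insert x (A - T)" "insert x A - insert x T = A - T"
    using assms by auto
  moreover have "x \<notin> T" "finite T"
    using assms by (auto dest: finite_subset)
  ultimately show "subset_prob (insert x A) \<alpha> T = (1 - \<alpha> x) * subset_prob A \<alpha> T"
    and "subset_prob (insert x A) \<alpha> (insert x T) = \<alpha> x * subset_prob A \<alpha> T"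
    using assms by (simp_all add: subset_prob_def)
qed

lemma subset_prob_nonneg:
  assumes "\<And>l. l \<in> A \<Longrightarrow> 0 \<le> \<alpha> l \<and> \<alpha> l \<le> 1" "S \<subseteq> A"
  shows "0 \<le> subset_prob A \<alpha> S"
  unfolding subset_prob_def using assms
  by (intro mult_nonneg_nonneg prod_nonneg) (auto simp: subset_iff)

lemma sum_Pow_insert:
  fixes G :: "'i set \<Rightarrow> 'b::comm_monoid_add"
  assumes "finite A" "x \<notin> A"
  shows "(\<Sum>S\<in>Pow (insert x A). G S) = (\<Sum>T\<in>Pow A. G T + G (insert x T))"
proof -
  have "inj_on (insert x) (Pow A)"
    using assms by (intro inj_onI) (metis PowD insert_ident subsetD)
  moreover have "Pow A \<inter> insert x ` Pow A = {}"
    using assms by auto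
  ultimately show ?thesis
    using assms by (simp add: Pow_insert sum.union_disjoint sum.reindex sum.distrib)
qed

lemma sum_subset_prob:
  assumes "finite A"
  shows "(\<Sum>S\<in>Pow A. subset_prob A \<alpha> S) = 1"
  using assms
proof (induction A)
  case empty
  then show ?case by (simp add: subset_prob_def)
next
  case (insert x A)
  have "(\<Sum>S\<in>Pow (insert x A). subset_prob (insert x A) \<alpha> S) = (\<Sum>T\<in>Pow A. subset_prob A \<alpha> T)"
    unfolding sum_Pow_insert[OF insert.hyps]
    by (intro sum.cong refl) (simp add: subset_prob_insert[OF insert.hyps] algebra_simps)
  then show ?case by (simp add: insert.IH)
qed

text \<open>
The right-hand side is the variance of the cardinality plus the square of its bias from \<open>a\<close>.
The base point \<open>a\<close> is arbitrary so that the induction goes through: including a new point replaces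
\<open>a\<close> by \<open>a - 1\<close>.
\<close>

lemma sum_subset_prob_square_deviation:
  assumes "finite A"
  shows "(\<Sum>S\<in>Pow A. subset_prob A \<alpha> S * (real (card S) - a)\<^sup>2)
    = (\<Sum>l\<in>A. \<alpha> l * (1 - \<alpha> l)) + ((\<Sum>l\<in>A. \<alpha> l) - a)\<^sup>2"
  using assms
proof (induction A arbitrary: a)
  case empty
  then show ?case by (simp add: subset_prob_def)
next
  case (insert x A)
  have card: "card (insert x T) = Suc (card T)" if "T \<subseteq> A" for T
    using that insert.hyps by (subst card_insert_disjoint) (auto dest: finite_subset)
  have "(\<Sum>S\<in>Pow (insert x A). subset_prob (insert x A) \<alpha> S * (real (card S) - a)\<^sup>2)
    = (\<Sum>T\<in>Pow A. (1 - \<alpha> x) * (subset_prob A \<alpha> T * (real (card T) - a)\<^sup>2)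
        + \<alpha> x * (subset_prob A \<alpha> T * (real (card T) - (a - 1))\<^sup>2))"
    unfolding sum_Pow_insert[OF insert.hyps]
    by (intro sum.cong refl) (simp add: subset_prob_insert[OF insert.hyps] card algebra_simps)
  also have "\<dots> = (1 - \<alpha> x) * ((\<Sum>l\<in>A. \<alpha> l * (1 - \<alpha> l)) + ((\<Sum>l\<in>A. \<alpha> l) - a)\<^sup>2)
      + \<alpha> x * ((\<Sum>l\<in>A. \<alpha> l * (1 - \<alpha> l)) + ((\<Sum>l\<in>A. \<alpha> l) - (a - 1))\<^sup>2)"
    by (simp add: sum.distrib sum_distrib_left[symmetric] insert.IH)
  also have "\<dots> = (\<Sum>l\<in>insert x A. \<alpha> l * (1 - \<alpha> l)) + ((\<Sum>l\<in>insert x A. \<alpha> l) - a)\<^sup>2"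
    using insert.hyps by (simp add: power2_eq_square algebra_simps)
  finally show ?case .
qed

text \<open>
Chebyshev's inequality: a cardinality above \<open>u\<close> deviates from its mean by more than
\<open>u - s\<close>, and its variance is at most its mean, hence at most \<open>s\<close>.
\<close>

lemma subset_prob_card_le:
  assumes "finite A" and \<alpha>: "\<And>l. l \<in> A \<Longrightarrow> 0 \<le> \<alpha> l \<and> \<alpha> l \<le> 1"
    and s: "(\<Sum>l\<in>A. \<alpha> l) \<le> s" and "s < u"
  shows "(\<Sum>S\<in>Pow A. of_bool (real (card S) \<le> u) * subset_prob A \<alpha> S) \<ge> 1 - s / (u - s)\<^sup>2"
proof -
  define a where "a = (\<Sum>l\<in>A. \<alpha> l)"
  have pos: "0 < u - s" using assms by simp
  have "1 - s / (u - s)\<^sup>2 \<le> 1 - (\<Sum>l\<in>A. \<alpha> l * (1 - \<alpha> l)) / (u - s)\<^sup>2"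
  proof -
    have "(\<Sum>l\<in>A. \<alpha> l * (1 - \<alpha> l)) \<le> (\<Sum>l\<in>A. \<alpha> l)"
      using \<alpha> by (intro sum_mono) (simp add: mult_left_le)
    then show ?thesis using s pos by (simp add: divide_right_mono)
  qed
  also have "\<dots> = (\<Sum>S\<in>Pow A. subset_prob A \<alpha> S * (1 - ((real (card S) - a) / (u - s))\<^sup>2))"
    using sum_subset_prob[OF \<open>finite A\<close>, of \<alpha>] sum_subset_prob_square_deviation[OF \<open>finite A\<close>, of \<alpha> a]
    by (simp add: right_diff_distrib sum_subtractf power_divide a_def flip: sum_divide_distrib)
  also have "\<dots> \<le> (\<Sum>S\<in>Pow A. of_bool (real (card S) \<le> u) * subset_prob A \<alpha> S)"
  proof (intro sum_mono)
    fix S assume "S \<in> Pow A"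
    then have nonneg: "0 \<le> subset_prob A \<alpha> S"
      using subset_prob_nonneg[of A \<alpha> S] \<alpha> by auto
    have "1 - ((real (card S) - a) / (u - s))\<^sup>2 \<le> of_bool (real (card S) \<le> u)"
    proof (cases "real (card S) \<le> u")
      case False
      then have "1 \<le> (real (card S) - a) / (u - s)"
        using s pos by (simp add: a_def)
      then show ?thesis using False one_le_power[of _ 2] by simp
    qed simp
    from mult_left_mono[OF this nonneg]
    show "subset_prob A \<alpha> S * (1 - ((real (card S) - a) / (u - s))\<^sup>2)
      \<le> of_bool (real (card S) \<le> u) * subset_prob A \<alpha> S"
      by (simp add: mult.commute)
  qed
  finally show ?thesis .
qed

section \<open>The one-dimensional two-point problem\<close>

text \<open>
With \<open>p\<close> and \<open>q\<close> the posterior masses of \<open>0\<close> and of \<open>m\<close>, the right-hand side is the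
posterior loss of the guess \<open>g\<close>. Its minimum over \<open>g\<close> is \<open>p * q / (p + q) * m\<^sup>2\<close>, which is
close to \<open>q * m\<^sup>2\<close> when \<open>0\<close> is much likelier than \<open>m\<close>.
\<close>

lemma two_point_inequality:
  fixes p q g m \<tau> :: real
  assumes "0 \<le> q" "q \<le> \<tau> * p" "0 < \<tau>"
  shows "q * m\<^sup>2 / (1 + \<tau>) \<le> p * g\<^sup>2 + q * (g - m)\<^sup>2"
proof -
  \<comment> \<open>Decreasing the mass of 0 to \<open>c\<close> makes the odds exactly \<open>\<tau>\<close>; the optimal guess is then \<open>\<tau> * k\<close>.\<close>
  define c k where "c = q / \<tau>" and "k = m / (1 + \<tau>)"
  have q: "q = c * \<tau>" and m: "m = (1 + \<tau>) * k" and "0 \<le> c" and "c \<le> p"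
    using assms by (simp_all add: c_def k_def field_simps)
  have "q * m\<^sup>2 / (1 + \<tau>) = c * \<tau> * (1 + \<tau>) * k\<^sup>2"
    using \<open>0 < \<tau>\<close> by (simp add: q m power2_eq_square)
  also have "\<dots> = c * g\<^sup>2 + q * (g - m)\<^sup>2 - c * (1 + \<tau>) * (g - \<tau> * k)\<^sup>2"
    by (simp add: q m power2_eq_square algebra_simps)
  also have "\<dots> \<le> c * g\<^sup>2 + q * (g - m)\<^sup>2"
    using \<open>0 \<le> c\<close> \<open>0 < \<tau>\<close> by simp
  also have "\<dots> \<le> p * g\<^sup>2 + q * (g - m)\<^sup>2"
    using \<open>c \<le> p\<close> by (simp add: mult_right_mono)
  finally show ?thesis .
qed

text \<open>
A lower bound on the Bayes risk, at unit noise, for a spike of height \<open>\<mu>\<close> with prior probability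
\<open>a\<close>. The factor \<open>1 - 1 / t\<^sup>2\<close> bounds the probability that the noise is at most \<open>t\<close>, and the
summand next to \<open>1\<close> in the denominator bounds the posterior odds of the spike on that event.
\<close>

definition spike_risk_bound :: "real \<Rightarrow> real \<Rightarrow> real \<Rightarrow> real" where
  "spike_risk_bound \<mu> t a = a * \<mu>\<^sup>2 * (1 - 1 / t\<^sup>2) / (1 + a / (1 - a) * exp (\<mu>\<^sup>2 / 2 + \<mu> * t))"

text \<open>
Both hypotheses are compared on the same point \<open>s * \<mu> + y\<close>, by a translation in the first
integral. For \<open>y \<le> s * t\<close> the posterior odds are at most \<open>\<tau>\<close>, and \<open>two_point_inequality\<close>
applies to the integrand.
\<close>

lemma two_point_risk:
  fixes g :: "real \<Rightarrow> real" and s \<mu> t a :: real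
  assumes g [measurable]: "g \<in> borel_measurable borel"
    and "0 < s" "0 < a" "a < 1" "0 < t" "0 \<le> \<mu>"
  defines "N \<equiv> density lborel (\<lambda>x. ennreal (normal_density 0 s x))"
  shows "ennreal (s\<^sup>2 * spike_risk_bound \<mu> t a)
    \<le> ennreal (1 - a) * (\<integral>\<^sup>+ y. ennreal ((g y)\<^sup>2) \<partial>N)
      + ennreal a * (\<integral>\<^sup>+ y. ennreal ((g (s * \<mu> + y) - s * \<mu>)\<^sup>2) \<partial>N)"
proof -
  define m where "m = s * \<mu>"
  define \<tau> where "\<tau> = a / (1 - a) * exp (\<mu>\<^sup>2 / 2 + \<mu> * t)"
  define \<phi> where "\<phi> = normal_density 0 s"
  have \<phi>_nonneg: "0 \<le> \<phi> x" for x by (simp add: \<phi>_def)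
  have [measurable]: "\<phi> \<in> borel_measurable borel" by (simp add: \<phi>_def)
  have "0 < \<tau>" using assms by (simp add: \<tau>_def)
  have shift: "\<phi> (m + y) * exp (\<mu>\<^sup>2 / 2 + \<mu> * y / s) = \<phi> y" for y
  proof -
    have "- (m + y)\<^sup>2 / (2 * s\<^sup>2) + (\<mu>\<^sup>2 / 2 + \<mu> * y / s) = - y\<^sup>2 / (2 * s\<^sup>2)"
      using \<open>0 < s\<close> by (simp add: m_def field_simps power2_eq_square)
    then show ?thesis
      by (simp add: \<phi>_def normal_density_def flip: exp_add)
  qed
  \<comment> \<open>The factor \<open>1 - y\<^sup>2 / (s * t)\<^sup>2\<close> is at most the indicator of \<open>y \<le> s * t\<close>; using it instead
    reduces the Gaussian tail bound to the second moment.\<close>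
  have pointwise: "a * \<phi> y * m\<^sup>2 / (1 + \<tau>) * (1 - y\<^sup>2 / (s * t)\<^sup>2)
      \<le> (1 - a) * (\<phi> (m + y) * (g (m + y))\<^sup>2) + a * (\<phi> y * (g (m + y) - m)\<^sup>2)" for y
  proof (cases "y \<le> s * t")
    case True
    have "a * \<phi> y \<le> \<tau> * ((1 - a) * \<phi> (m + y))"
    proof -
      have "\<mu> * y / s \<le> \<mu> * t"
        using True assms by (simp add: field_simps mult_left_mono)
      then have "\<phi> y \<le> \<phi> (m + y) * exp (\<mu>\<^sup>2 / 2 + \<mu> * t)"
        unfolding shift[of y, symmetric] by (intro mult_left_mono \<phi>_nonneg) (simp add: mult.commute)
      then have "a * \<phi> y \<le> a * (\<phi> (m + y) * exp (\<mu>\<^sup>2 / 2 + \<mu> * t))"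
        using assms by (intro mult_left_mono) simp_all
      then show ?thesis using assms by (simp add: \<tau>_def mult_ac)
    qed
    from two_point_inequality[OF _ this \<open>0 < \<tau>\<close>, of m "g (m + y)"]
    have "a * \<phi> y * m\<^sup>2 / (1 + \<tau>)
      \<le> (1 - a) * (\<phi> (m + y) * (g (m + y))\<^sup>2) + a * (\<phi> y * (g (m + y) - m)\<^sup>2)"
      using \<phi>_nonneg assms by (simp add: mult.assoc)
    moreover have "a * \<phi> y * m\<^sup>2 / (1 + \<tau>) * (1 - y\<^sup>2 / (s * t)\<^sup>2) \<le> a * \<phi> y * m\<^sup>2 / (1 + \<tau>) * 1"
      using \<phi>_nonneg \<open>0 < \<tau>\<close> assms by (intro mult_left_mono) simp_all
    ultimately show ?thesis by linarith
  next
    case False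
    have "0 < s * t" using assms by simp
    then have "(s * t)\<^sup>2 \<le> y\<^sup>2" using False by (intro power_mono) simp_all
    then have "1 - y\<^sup>2 / (s * t)\<^sup>2 \<le> 0" 
      using zero_less_power[OF \<open>0 < s * t\<close>, of 2] by (simp only: diff_le_0_iff_le le_divide_eq_1_pos)
    then have "a * \<phi> y * m\<^sup>2 / (1 + \<tau>) * (1 - y\<^sup>2 / (s * t)\<^sup>2) \<le> 0"
      using \<phi>_nonneg \<open>0 < \<tau>\<close> assms by (intro mult_nonneg_nonpos) simp_all
    also have "0 \<le> (1 - a) * (\<phi> (m + y) * (g (m + y))\<^sup>2) + a * (\<phi> y * (g (m + y) - m)\<^sup>2)"
      using \<phi>_nonneg assms by simp
    finally show ?thesis .
  qed
  have mass: "has_bochner_integral lborel \<phi> 1"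
    using normal_moment_even[OF \<open>0 < s\<close>, of 0 0] by (simp add: \<phi>_def)
  have moment: "has_bochner_integral lborel (\<lambda>y. \<phi> y * y\<^sup>2) (s\<^sup>2)"
    using normal_moment_even[OF \<open>0 < s\<close>, of 0 1] by (simp add: \<phi>_def fact_2 power2_eq_square)
  have lower: "has_bochner_integral lborel
      (\<lambda>y. a * \<phi> y * m\<^sup>2 / (1 + \<tau>) * (1 - y\<^sup>2 / (s * t)\<^sup>2)) (s\<^sup>2 * spike_risk_bound \<mu> t a)"
  proof -
    have "has_bochner_integral lborel
      (\<lambda>y. a * m\<^sup>2 / (1 + \<tau>) * (\<phi> y - \<phi> y * y\<^sup>2 / (s * t)\<^sup>2)) (a * m\<^sup>2 / (1 + \<tau>) * (1 - s\<^sup>2 / (s * t)\<^sup>2))"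
      by (intro has_bochner_integral_mult_right has_bochner_integral_diff
          has_bochner_integral_divide_zero mass moment)
    moreover have "a * m\<^sup>2 / (1 + \<tau>) * (1 - s\<^sup>2 / (s * t)\<^sup>2) = s\<^sup>2 * spike_risk_bound \<mu> t a"
      using \<open>0 < s\<close> by (simp add: spike_risk_bound_def m_def \<tau>_def power_mult_distrib)
    ultimately show ?thesis by (simp add: algebra_simps)
  qed
  have "ennreal (s\<^sup>2 * spike_risk_bound \<mu> t a)
    \<le> (\<integral>\<^sup>+ y. ennreal (a * \<phi> y * m\<^sup>2 / (1 + \<tau>) * (1 - y\<^sup>2 / (s * t)\<^sup>2)) \<partial>lborel)"
  proof -
    let ?h = "\<lambda>y. a * \<phi> y * m\<^sup>2 / (1 + \<tau>) * (1 - y\<^sup>2 / (s * t)\<^sup>2)"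
    have "(\<integral>y. ?h y \<partial>lborel) \<le> (\<integral>y. max 0 (?h y) \<partial>lborel)"
      using lower by (intro integral_mono integrable_max) (auto simp: has_bochner_integral_iff)
    then have "ennreal (s\<^sup>2 * spike_risk_bound \<mu> t a) \<le> ennreal (\<integral>y. max 0 (?h y) \<partial>lborel)"
      using lower by (intro ennreal_leI) (simp add: has_bochner_integral_iff)
    also have "\<dots> = (\<integral>\<^sup>+ y. ennreal (max 0 (?h y)) \<partial>lborel)"
      using lower by (intro nn_integral_eq_integral[symmetric] integrable_max)
        (auto simp: has_bochner_integral_iff)
    also have "(\<lambda>y. ennreal (max 0 (?h y))) = (\<lambda>y. ennreal (?h y))"
      by (intro ext) (metis ennreal_neg linear max.absorb1 max.absorb2 ennreal_0)
    finally show ?thesis .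
  qed
  also have "\<dots> \<le> (\<integral>\<^sup>+ y. ennreal ((1 - a) * (\<phi> (m + y) * (g (m + y))\<^sup>2) + a * (\<phi> y * (g (m + y) - m)\<^sup>2)) \<partial>lborel)"
    by (intro nn_integral_mono ennreal_leI pointwise)
  also have "\<dots> = ennreal (1 - a) * (\<integral>\<^sup>+ y. ennreal (\<phi> (m + y) * (g (m + y))\<^sup>2) \<partial>lborel)
      + ennreal a * (\<integral>\<^sup>+ y. ennreal (\<phi> y * (g (m + y) - m)\<^sup>2) \<partial>lborel)"
    using assms \<phi>_nonneg
    by (subst nn_integral_cmult[symmetric], measurable)+
      (subst nn_integral_add[symmetric], measurable, auto intro!: nn_integral_cong simp: ennreal_mult'' ennreal_plus mult.commute)
  also have "(\<integral>\<^sup>+ y. ennreal (\<phi> (m + y) * (g (m + y))\<^sup>2) \<partial>lborel) = (\<integral>\<^sup>+ y. ennreal (\<phi> y * (g y)\<^sup>2) \<partial>lborel)"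
    using nn_integral_real_affine[of "\<lambda>y. ennreal (\<phi> y * (g y)\<^sup>2)" 1 m] by simp
  also have "(\<integral>\<^sup>+ y. ennreal (\<phi> y * (g y)\<^sup>2) \<partial>lborel) = (\<integral>\<^sup>+ y. ennreal ((g y)\<^sup>2) \<partial>N)"
    using \<phi>_nonneg by (simp add: N_def nn_integral_density ennreal_mult' flip: \<phi>_def)
  also have "(\<integral>\<^sup>+ y. ennreal (\<phi> y * (g (m + y) - m)\<^sup>2) \<partial>lborel) = (\<integral>\<^sup>+ y. ennreal ((g (m + y) - m)\<^sup>2) \<partial>N)"
    using \<phi>_nonneg by (simp add: N_def nn_integral_density ennreal_mult' flip: \<phi>_def)
  finally show ?thesis by (simp add: m_def)
qed

text \<open>
Here \<open>a = exp (- 2 * x ^ 4)\<close>, so that \<open>sqrt (2 * ln (1 / a)) = 2 * x\<^sup>2\<close>, and the spike height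
falls short of this critical value by \<open>2 * x\<close>. With \<open>t = x\<close> the exponent of the posterior odds is
\<open>- 2 * x ^ 4 + \<mu>\<^sup>2 / 2 + \<mu> * t = - 2 * x ^ 3\<close>, so the odds vanish although \<open>\<mu>\<close> is
asymptotically critical and \<open>t\<close> tends to infinity.
\<close>

lemma spike_risk_bound_asymp:
  "((\<lambda>x. spike_risk_bound (2 * x\<^sup>2 - 2 * x) x (exp (- 2 * x ^ 4)) / (4 * x ^ 4 * exp (- 2 * x ^ 4))) \<longlongrightarrow> 1) at_top"
  unfolding spike_risk_bound_def
  by real_asymp

lemma spike_risk_bound_exists:
  assumes "0 < \<epsilon>"
  obtains a0 where "0 < a0" "a0 < 1"
    "\<And>a. 0 < a \<Longrightarrow> a \<le> a0 \<Longrightarrow>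
       \<exists>\<mu> t. 0 \<le> \<mu> \<and> 0 < t \<and> (1 - \<epsilon>) * (2 * a * ln (inverse a)) \<le> spike_risk_bound \<mu> t a"
proof -
  from order_tendstoD(1)[OF spike_risk_bound_asymp, of "1 - \<epsilon>"] assms
  have "\<forall>\<^sub>F x in at_top. 1 - \<epsilon> <
      spike_risk_bound (2 * x\<^sup>2 - 2 * x) x (exp (- 2 * x ^ 4)) / (4 * x ^ 4 * exp (- 2 * x ^ 4))"
    by simp
  then obtain x0 where x0: "\<And>x. x0 \<le> x \<Longrightarrow> 1 - \<epsilon> <
      spike_risk_bound (2 * x\<^sup>2 - 2 * x) x (exp (- 2 * x ^ 4)) / (4 * x ^ 4 * exp (- 2 * x ^ 4))"
    by (auto simp: eventually_at_top_linorder)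
  define x1 where "x1 = max 1 x0"
  show thesis
  proof
    show "0 < exp (- 2 * x1 ^ 4)" by simp
    show "exp (- 2 * x1 ^ 4) < 1" by (simp add: x1_def)
    fix a :: real assume a: "0 < a" "a \<le> exp (- 2 * x1 ^ 4)"
    define x where "x = root 4 (ln (inverse a) / 2)"
    have "ln a \<le> - 2 * x1 ^ 4"
      using a by (metis ln_exp ln_le_cancel_iff exp_gt_zero)
    then have L: "x1 ^ 4 \<le> ln (inverse a) / 2"
      using a by (simp add: ln_inverse)
    then have "root 4 (x1 ^ 4) \<le> x"
      unfolding x_def by (intro real_root_le_mono) simp_all
    then have "x1 \<le> x"
      by (subst (asm) real_root_power_cancel) (simp_all add: x1_def)
    then have x: "1 \<le> x" "x0 \<le> x" by (simp_all add: x1_def)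
    have "0 \<le> ln (inverse a) / 2"
      using L by (smt (verit) zero_le_even_power even_numeral)
    then have x4: "x ^ 4 = ln (inverse a) / 2"
      by (simp add: x_def)
    then have a_eq: "exp (- 2 * x ^ 4) = a"
      using a by (simp add: ln_inverse)
    have "1 - \<epsilon> < spike_risk_bound (2 * x\<^sup>2 - 2 * x) x a / (2 * a * ln (inverse a))"
      using x0[OF x(2)] unfolding a_eq by (simp add: x4 mult_ac)
    moreover have "0 < ln (inverse a)"
      using x4 x by (smt (verit) one_le_power half_gt_zero_iff)
    ultimately have "(1 - \<epsilon>) * (2 * a * ln (inverse a)) \<le> spike_risk_bound (2 * x\<^sup>2 - 2 * x) x a"
      using a by (simp add: pos_less_divide_eq)
    moreover have "0 \<le> 2 * x\<^sup>2 - 2 * x"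
      using x by (simp add: power2_eq_square)
    ultimately show "\<exists>\<mu> t. 0 \<le> \<mu> \<and> 0 < t \<and> (1 - \<epsilon>) * (2 * a * ln (inverse a)) \<le> spike_risk_bound \<mu> t a"
      using x by (intro exI[of _ "2 * x\<^sup>2 - 2 * x"] exI[of _ x]) simp
  qed
qed

section \<open>The risk of one coordinate\<close>

definition spikes :: "'i set \<Rightarrow> ('i \<Rightarrow> real) \<Rightarrow> 'i set \<Rightarrow> 'i \<Rightarrow> real" where
  "spikes \<Lambda> m S = (\<lambda>l\<in>\<Lambda>. if l \<in> S then m l else 0)"

lemma spikes_in_sparse_class:
  assumes "finite \<Lambda>" "S \<subseteq> \<Lambda>" "real (card S) \<le> real (card \<Lambda>) * \<gamma>"
  shows "spikes \<Lambda> m S \<in> sparse_class \<Lambda> \<gamma>"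
proof -
  have "(\<Sum>l\<in>\<Lambda>. of_bool (spikes \<Lambda> m S l \<noteq> 0)) \<le> (\<Sum>l\<in>\<Lambda>. of_bool (l \<in> S) :: real)"
    by (intro sum_mono) (simp add: spikes_def)
  also have "\<dots> = real (card S)"
    using assms by (simp add: sum_of_bool_eq Int_absorb1)
  finally show ?thesis
    using assms by (simp add: sparse_class_def) (simp add: spikes_def)
qed

definition coord_risk ::
  "'i set \<Rightarrow> ('i \<Rightarrow> real) \<Rightarrow> (('i \<Rightarrow> real) \<Rightarrow> 'i \<Rightarrow> real) \<Rightarrow> ('i \<Rightarrow> real) \<Rightarrow> 'i \<Rightarrow> ennreal" where
  "coord_risk \<Lambda> \<sigma> fhat f l = (\<integral>\<^sup>+ X. ennreal ((fhat X l - f l)\<^sup>2) \<partial>obs_law \<Lambda> \<sigma> f)"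

lemma estimator_component_measurable:
  assumes "fhat \<in> estimators \<Lambda>" "l \<in> \<Lambda>"
  shows "(\<lambda>X. fhat X l) \<in> borel_measurable (PiM \<Lambda> (\<lambda>_. borel))"
  using assms measurable_compose[of fhat _ _ "\<lambda>X. X l"]
  by (simp add: estimators_def)

lemma risk_eq_sum_coord_risk:
  assumes "fhat \<in> estimators \<Lambda>"
  shows "risk \<Lambda> \<sigma> fhat f = (\<Sum>l\<in>\<Lambda>. coord_risk \<Lambda> \<sigma> fhat f l)"
proof -
  have "risk \<Lambda> \<sigma> fhat f = (\<integral>\<^sup>+ X. (\<Sum>l\<in>\<Lambda>. ennreal ((fhat X l - f l)\<^sup>2)) \<partial>obs_law \<Lambda> \<sigma> f)"
    by (simp add: risk_def)
  also have "\<dots> = (\<Sum>l\<in>\<Lambda>. coord_risk \<Lambda> \<sigma> fhat f l)"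
    unfolding coord_risk_def
  proof (rule nn_integral_sum)
    fix l assume "l \<in> \<Lambda>"
    from estimator_component_measurable[OF assms this]
    show "(\<lambda>X. ennreal ((fhat X l - f l)\<^sup>2)) \<in> borel_measurable (obs_law \<Lambda> \<sigma> f)"
      by (simp add: obs_law_def)
  qed
  finally show ?thesis .
qed

text \<open>
Only the noise of coordinate \<open>l\<close> is integrated in the inner integral. The outer integral is over the other
noise variables, whose law does not involve \<open>f\<close>; hence two parameters that differ only at \<open>l\<close>
can be compared under one outer integral.
\<close>

lemma coord_risk_Fubini:
  fixes \<sigma> :: "'i \<Rightarrow> real"
  assumes "finite \<Lambda>" "l \<in> \<Lambda>" and \<sigma>: "\<And>l. l \<in> \<Lambda> \<Longrightarrow> 0 < \<sigma> l" and fhat: "fhat \<in> estimators \<Lambda>"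
  defines "N \<equiv> (\<lambda>k. density lborel (\<lambda>x. ennreal (normal_density 0 (\<sigma> k) x)))"
  shows "coord_risk \<Lambda> \<sigma> fhat f l =
    (\<integral>\<^sup>+ \<xi>. \<integral>\<^sup>+ y. ennreal ((fhat ((\<lambda>k\<in>\<Lambda>. f k + \<xi> k)(l := f l + y)) l - f l)\<^sup>2) \<partial>N l \<partial>PiM (\<Lambda> - {l}) N)"
proof -
  \<comment> \<open>The product locale needs probability measures at every index, also outside \<open>\<Lambda>\<close>, where
    \<open>\<sigma>\<close> is arbitrary.\<close>
  define N' where "N' k = (if k \<in> \<Lambda> then N k else N l)" for k
  have prob: "prob_space (N' k)" for k
    using prob_space_normal_density \<sigma> assms(2) by (auto simp: N'_def N_def)
  interpret product_prob_space N' by (intro product_prob_spaceI prob)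
  have sets [measurable_cong]: "sets (N' k) = sets borel" for k
    by (simp add: N'_def N_def)
  have PiM_eq: "PiM \<Lambda> N = PiM \<Lambda> N'" "PiM (\<Lambda> - {l}) N = PiM (\<Lambda> - {l}) N'"
    by (auto intro!: PiM_cong simp: N'_def)
  have noise: "noise_law \<Lambda> \<sigma> = PiM \<Lambda> N'"
    by (simp add: noise_law_def PiM_eq[symmetric] N_def)
  have shift [measurable]: "(\<lambda>\<xi>. \<lambda>k\<in>\<Lambda>. f k + \<xi> k) \<in> measurable (PiM \<Lambda> N') (PiM \<Lambda> (\<lambda>_. borel))"
    by (intro measurable_restrict) measurable
  note [measurable] = estimator_component_measurable[OF fhat \<open>l \<in> \<Lambda>\<close>]
  have insert: "insert l (\<Lambda> - {l}) = \<Lambda>" using \<open>l \<in> \<Lambda>\<close> by auto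
  have "coord_risk \<Lambda> \<sigma> fhat f l
      = (\<integral>\<^sup>+ \<xi>. ennreal ((fhat (\<lambda>k\<in>\<Lambda>. f k + \<xi> k) l - f l)\<^sup>2) \<partial>PiM \<Lambda> N')"
    unfolding coord_risk_def obs_law_def noise by (intro nn_integral_distr) measurable
  also have "\<dots> = (\<integral>\<^sup>+ \<xi>. \<integral>\<^sup>+ y. ennreal ((fhat (\<lambda>k\<in>\<Lambda>. f k + (\<xi>(l := y)) k) l - f l)\<^sup>2) \<partial>N' l \<partial>PiM (\<Lambda> - {l}) N')"
    using product_nn_integral_insert[of "\<Lambda> - {l}" l "\<lambda>\<xi>. ennreal ((fhat (\<lambda>k\<in>\<Lambda>. f k + \<xi> k) l - f l)\<^sup>2)"]
    using \<open>finite \<Lambda>\<close> unfolding insert by simp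
  also have "\<dots> = (\<integral>\<^sup>+ \<xi>. \<integral>\<^sup>+ y. ennreal ((fhat ((\<lambda>k\<in>\<Lambda>. f k + \<xi> k)(l := f l + y)) l - f l)\<^sup>2) \<partial>N l \<partial>PiM (\<Lambda> - {l}) N)"
  proof -
    have "(\<lambda>k\<in>\<Lambda>. f k + (\<xi>(l := y)) k) = (\<lambda>k\<in>\<Lambda>. f k + \<xi> k)(l := f l + y)" for \<xi> y
      using \<open>l \<in> \<Lambda>\<close> by auto
    then show ?thesis using \<open>l \<in> \<Lambda>\<close> by (simp only: PiM_eq N'_def if_True)
  qed
  finally show ?thesis .
qed

text \<open>
With the noise of the other coordinates fixed, the component \<open>fhat X l\<close> is a function of the
\<open>l\<close>-th observation alone. It is the same function for \<open>T\<close> and for \<open>insert l T\<close>, because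
the corresponding parameters agree off \<open>l\<close>. Thus the one-dimensional bound applies inside the outer
integral.
\<close>

lemma coord_risk_two_point:
  fixes \<sigma> :: "'i \<Rightarrow> real"
  assumes "finite \<Lambda>" "l \<in> \<Lambda>" and \<sigma>: "\<And>l. l \<in> \<Lambda> \<Longrightarrow> 0 < \<sigma> l" and fhat: "fhat \<in> estimators \<Lambda>"
    and "T \<subseteq> \<Lambda> - {l}" "0 < a" "a < 1" "0 < t" "0 \<le> \<mu>" "m l = \<sigma> l * \<mu>"
  shows "ennreal ((\<sigma> l)\<^sup>2 * spike_risk_bound \<mu> t a)
    \<le> ennreal (1 - a) * coord_risk \<Lambda> \<sigma> fhat (spikes \<Lambda> m T) l
      + ennreal a * coord_risk \<Lambda> \<sigma> fhat (spikes \<Lambda> m (insert l T)) l"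
proof -
  define N where "N k = density lborel (\<lambda>x. ennreal (normal_density 0 (\<sigma> k) x))" for k
  \<comment> \<open>\<open>G \<xi> u\<close> is the \<open>l\<close>-th estimate when the \<open>l\<close>-th observation is \<open>u\<close> and the others have noise \<open>\<xi>\<close>.\<close>
  define G where "G \<xi> u = fhat ((\<lambda>k\<in>\<Lambda>. spikes \<Lambda> m T k + \<xi> k)(l := u)) l" for \<xi> u
  let ?P = "PiM (\<Lambda> - {l}) N"
  have prob: "prob_space ?P"
    unfolding N_def by (intro prob_space_PiM prob_space_normal_density \<sigma>) auto
  have sets [measurable_cong]: "sets (N k) = sets borel" for k
    by (simp add: N_def)
  have sf: "sigma_finite_measure (N l)"
    using prob_space_normal_density[OF \<sigma>[OF \<open>l \<in> \<Lambda>\<close>], of 0]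
    by (simp add: N_def prob_space_imp_sigma_finite)
  note comp [measurable] = estimator_component_measurable[OF fhat \<open>l \<in> \<Lambda>\<close>]
  have upd: "(\<lambda>(\<xi>, u). (\<lambda>k\<in>\<Lambda>. spikes \<Lambda> m T k + \<xi> k)(l := u)) \<in> measurable (?P \<Otimes>\<^sub>M borel) (PiM \<Lambda> (\<lambda>_. borel))"
  proof -
    have "(\<lambda>(\<xi>, u). (\<lambda>k\<in>\<Lambda>. spikes \<Lambda> m T k + \<xi> k)(l := u))
      = (\<lambda>(\<xi>, u). \<lambda>k\<in>\<Lambda>. if k = l then u else spikes \<Lambda> m T k + \<xi> k)"
      using \<open>l \<in> \<Lambda>\<close> by (auto simp: fun_eq_iff)
    moreover have "\<dots> \<in> measurable (?P \<Otimes>\<^sub>M borel) (PiM \<Lambda> (\<lambda>_. borel))"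
      unfolding case_prod_beta
    proof (intro measurable_restrict)
      fix k assume "k \<in> \<Lambda>"
      then show "(\<lambda>x. if k = l then snd x else spikes \<Lambda> m T k + fst x k) \<in> measurable (?P \<Otimes>\<^sub>M borel) borel"
        by (cases "k = l") (simp_all, measurable)
    qed
    ultimately show ?thesis by simp
  qed
  have G [measurable]: "case_prod G \<in> borel_measurable (?P \<Otimes>\<^sub>M borel)"
    using measurable_compose[OF upd comp] by (simp add: G_def case_prod_beta')
  have G1 [measurable]: "G \<xi> \<in> borel_measurable borel" if "\<xi> \<in> space ?P" for \<xi>
    using measurable_compose_Pair1[OF that G] by simp
  have T: "coord_risk \<Lambda> \<sigma> fhat (spikes \<Lambda> m T) l = (\<integral>\<^sup>+ \<xi>. \<integral>\<^sup>+ y. ennreal ((G \<xi> y)\<^sup>2) \<partial>N l \<partial>?P)"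
    using assms(2,5) coord_risk_Fubini[OF assms(1,2) \<sigma> fhat, where f = "spikes \<Lambda> m T"]
    by (auto simp: G_def N_def[abs_def] spikes_def subset_iff)
  have eq: "(\<lambda>k\<in>\<Lambda>. spikes \<Lambda> m (insert l T) k + \<xi> k)(l := u) = (\<lambda>k\<in>\<Lambda>. spikes \<Lambda> m T k + \<xi> k)(l := u)" for \<xi> u
    by (auto simp: spikes_def)
  have I: "coord_risk \<Lambda> \<sigma> fhat (spikes \<Lambda> m (insert l T)) l
      = (\<integral>\<^sup>+ \<xi>. \<integral>\<^sup>+ y. ennreal ((G \<xi> (\<sigma> l * \<mu> + y) - \<sigma> l * \<mu>)\<^sup>2) \<partial>N l \<partial>?P)"
  proof -
    have "spikes \<Lambda> m (insert l T) l = \<sigma> l * \<mu>"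
      using assms by (simp add: spikes_def)
    then show ?thesis
      using coord_risk_Fubini[OF assms(1,2) \<sigma> fhat, where f = "spikes \<Lambda> m (insert l T)"]
      by (simp add: G_def N_def[abs_def] eq)
  qed
  have meas: "(\<lambda>\<xi>. \<integral>\<^sup>+ y. ennreal ((G \<xi> (c + y) - c)\<^sup>2) \<partial>N l) \<in> borel_measurable ?P" for c
  proof (rule sigma_finite_measure.borel_measurable_nn_integral[OF sf])
    have "(\<lambda>x. case_prod G (fst x, c + snd x)) \<in> borel_measurable (?P \<Otimes>\<^sub>M N l)"
      by (rule measurable_compose[OF _ G]) measurable
    then have [measurable]: "(\<lambda>x. G (fst x) (c + snd x)) \<in> borel_measurable (?P \<Otimes>\<^sub>M N l)"
      by simp
    show "(\<lambda>(\<xi>, y). ennreal ((G \<xi> (c + y) - c)\<^sup>2)) \<in> borel_measurable (?P \<Otimes>\<^sub>M N l)"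
      unfolding case_prod_beta by measurable
  qed
  have "ennreal ((\<sigma> l)\<^sup>2 * spike_risk_bound \<mu> t a)
      = (\<integral>\<^sup>+ \<xi>. ennreal ((\<sigma> l)\<^sup>2 * spike_risk_bound \<mu> t a) \<partial>?P)"
    using prob by (simp add: prob_space.emeasure_space_1)
  also have "\<dots> \<le> (\<integral>\<^sup>+ \<xi>. ennreal (1 - a) * (\<integral>\<^sup>+ y. ennreal ((G \<xi> y)\<^sup>2) \<partial>N l)
      + ennreal a * (\<integral>\<^sup>+ y. ennreal ((G \<xi> (\<sigma> l * \<mu> + y) - \<sigma> l * \<mu>)\<^sup>2) \<partial>N l) \<partial>?P)"
    unfolding N_def[of l]
    by (intro nn_integral_mono two_point_risk) (use assms G1 in \<open>auto simp: N_def[abs_def]\<close>)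
  also have "\<dots> = ennreal (1 - a) * coord_risk \<Lambda> \<sigma> fhat (spikes \<Lambda> m T) l
      + ennreal a * coord_risk \<Lambda> \<sigma> fhat (spikes \<Lambda> m (insert l T)) l"
    unfolding T I using meas meas[of 0] by (simp add: nn_integral_add nn_integral_cmult)
  finally show ?thesis .
qed

section \<open>Averaging over sparse spike configurations\<close>

text \<open>
The sum over sparse subsets is paired along \<open>l\<close>. A pair \<open>T\<close>, \<open>insert l T\<close> is used only when
\<open>T\<close> has at most \<open>R - 1\<close> elements: both members are then sparse, and the pair contributes its
full two-point risk. The total probability of these \<open>T\<close> is bounded by Chebyshev's inequality.
\<close>

lemma truncated_Bayes_coord_risk:
  fixes \<sigma> :: "'i \<Rightarrow> real"
  assumes "finite \<Lambda>" "l \<in> \<Lambda>" and \<sigma>: "\<And>k. k \<in> \<Lambda> \<Longrightarrow> 0 < \<sigma> k" and fhat: "fhat \<in> estimators \<Lambda>"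
    and \<alpha>: "\<And>k. k \<in> \<Lambda> \<Longrightarrow> 0 \<le> \<alpha> k \<and> \<alpha> k < 1"
    and s: "(\<Sum>k\<in>\<Lambda>. \<alpha> k) \<le> s" "s < R - 1"
    and spike: "0 < \<alpha> l" "0 < t" "0 \<le> \<mu>" "m l = \<sigma> l * \<mu>"
    and b: "0 \<le> b" "b \<le> spike_risk_bound \<mu> t (\<alpha> l)"
  shows "ennreal ((1 - s / (R - 1 - s)\<^sup>2) * ((\<sigma> l)\<^sup>2 * b))
    \<le> (\<Sum>S\<in>Pow \<Lambda>. ennreal (of_bool (real (card S) \<le> R) * subset_prob \<Lambda> \<alpha> S)
          * coord_risk \<Lambda> \<sigma> fhat (spikes \<Lambda> m S) l)"
proof -
  define A where "A = \<Lambda> - {l}"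
  have A: "finite A" "l \<notin> A" "insert l A = \<Lambda>" using assms(1,2) by (auto simp: A_def)
  have \<alpha>': "0 \<le> \<alpha> k \<and> \<alpha> k \<le> 1" if "k \<in> A" for k using \<alpha>[of k] that A(3) by auto
  define w where "w T = of_bool (real (card T) \<le> R - 1) * subset_prob A \<alpha> T" for T
  have w: "0 \<le> w T" if "T \<in> Pow A" for T
    using subset_prob_nonneg[of A \<alpha> T] \<alpha>' that by (simp add: w_def)
  define G where "G S = ennreal (of_bool (real (card S) \<le> R) * subset_prob \<Lambda> \<alpha> S)
          * coord_risk \<Lambda> \<sigma> fhat (spikes \<Lambda> m S) l" for S
  have pair: "ennreal (w T * ((\<sigma> l)\<^sup>2 * b)) \<le> G T + G (insert l T)" if T: "T \<in> Pow A" for T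
  proof (cases "real (card T) \<le> R - 1")
    case True
    have T': "T \<subseteq> A" "finite T" "l \<notin> T" using T A by (auto dest: finite_subset)
    have "ennreal (w T * ((\<sigma> l)\<^sup>2 * b)) = ennreal (w T) * ennreal ((\<sigma> l)\<^sup>2 * b)"
      using w[OF T] by (simp add: ennreal_mult')
    also have "\<dots> \<le> ennreal (w T) * (ennreal (1 - \<alpha> l) * coord_risk \<Lambda> \<sigma> fhat (spikes \<Lambda> m T) l
      + ennreal (\<alpha> l) * coord_risk \<Lambda> \<sigma> fhat (spikes \<Lambda> m (insert l T)) l)"
    proof (intro mult_left_mono)
      have "ennreal ((\<sigma> l)\<^sup>2 * b) \<le> ennreal ((\<sigma> l)\<^sup>2 * spike_risk_bound \<mu> t (\<alpha> l))"
        using b by (intro ennreal_leI mult_left_mono) simp_all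
      also have "\<dots> \<le> ennreal (1 - \<alpha> l) * coord_risk \<Lambda> \<sigma> fhat (spikes \<Lambda> m T) l
      + ennreal (\<alpha> l) * coord_risk \<Lambda> \<sigma> fhat (spikes \<Lambda> m (insert l T)) l"
        using T' \<alpha>[OF \<open>l \<in> \<Lambda>\<close>] spike
        by (intro coord_risk_two_point assms(1-4)) (auto simp: A_def)
      finally show "ennreal ((\<sigma> l)\<^sup>2 * b) \<le> \<dots>" .
    qed simp
    also have "\<dots> = G T + G (insert l T)"
    proof -
      have "subset_prob \<Lambda> \<alpha> T = (1 - \<alpha> l) * subset_prob A \<alpha> T"
        "subset_prob \<Lambda> \<alpha> (insert l T) = \<alpha> l * subset_prob A \<alpha> T"
        using subset_prob_insert[OF A(1,2) T'(1), of \<alpha>] by (simp_all add: A(3))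
      moreover have "real (card T) \<le> R" "real (card (insert l T)) \<le> R"
        using True T' by simp_all
      moreover have "w T = subset_prob A \<alpha> T" using True by (simp add: w_def)
      ultimately show ?thesis
        using w[OF T] \<alpha>[OF \<open>l \<in> \<Lambda>\<close>]
        by (simp add: G_def ennreal_mult distrib_left mult_ac)
    qed
    finally show ?thesis .
  qed (simp add: w_def)
  have "(1 - s / (R - 1 - s)\<^sup>2) * ((\<sigma> l)\<^sup>2 * b) \<le> (\<Sum>T\<in>Pow A. w T) * ((\<sigma> l)\<^sup>2 * b)"
  proof (intro mult_right_mono)
    have "(\<Sum>k\<in>A. \<alpha> k) \<le> (\<Sum>k\<in>\<Lambda>. \<alpha> k)"
      using assms(1) \<alpha> A by (intro sum_mono2) auto
    then show "1 - s / (R - 1 - s)\<^sup>2 \<le> (\<Sum>T\<in>Pow A. w T)"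
      unfolding w_def using s by (intro subset_prob_card_le A \<alpha>') auto
    show "0 \<le> (\<sigma> l)\<^sup>2 * b" using b by simp
  qed
  then have "ennreal ((1 - s / (R - 1 - s)\<^sup>2) * ((\<sigma> l)\<^sup>2 * b)) \<le> ennreal (\<Sum>T\<in>Pow A. w T * ((\<sigma> l)\<^sup>2 * b))"
    by (intro ennreal_leI) (simp add: sum_distrib_right)
  also have "\<dots> = (\<Sum>T\<in>Pow A. ennreal (w T * ((\<sigma> l)\<^sup>2 * b)))"
    using w b by (intro sum_ennreal[symmetric]) simp
  also have "\<dots> \<le> (\<Sum>T\<in>Pow A. G T + G (insert l T))"
    by (intro sum_mono pair)
  also have "\<dots> = (\<Sum>S\<in>Pow \<Lambda>. G S)"
    using sum_Pow_insert[OF A(1,2), of G] by (simp add: A(3))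
  finally show ?thesis by (simp add: G_def)
qed

text \<open>
The maximum dominates any average with total weight at most one over parameters in the
sparsity class. The weights are left unnormalized, so no division by the probability of sparsity occurs.
\<close>

lemma max_risk_ge_truncated_Bayes_risk:
  assumes "finite \<Lambda>" and fhat: "fhat \<in> estimators \<Lambda>"
    and \<alpha>: "\<And>k. k \<in> \<Lambda> \<Longrightarrow> 0 \<le> \<alpha> k \<and> \<alpha> k \<le> 1"
  shows "(\<Sum>l\<in>\<Lambda>. \<Sum>S\<in>Pow \<Lambda>. ennreal (of_bool (real (card S) \<le> real (card \<Lambda>) * \<gamma>) * subset_prob \<Lambda> \<alpha> S)
          * coord_risk \<Lambda> \<sigma> fhat (spikes \<Lambda> m S) l) \<le> max_risk \<Lambda> \<sigma> \<gamma> fhat"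
proof -
  define w where "w S = of_bool (real (card S) \<le> real (card \<Lambda>) * \<gamma>) * subset_prob \<Lambda> \<alpha> S" for S
  have w: "0 \<le> w S" "w S \<le> subset_prob \<Lambda> \<alpha> S" if "S \<in> Pow \<Lambda>" for S
    using subset_prob_nonneg[of \<Lambda> \<alpha> S] \<alpha> that by (simp_all add: w_def)
  have "(\<Sum>l\<in>\<Lambda>. \<Sum>S\<in>Pow \<Lambda>. ennreal (w S) * coord_risk \<Lambda> \<sigma> fhat (spikes \<Lambda> m S) l)
      = (\<Sum>S\<in>Pow \<Lambda>. ennreal (w S) * risk \<Lambda> \<sigma> fhat (spikes \<Lambda> m S))"
    by (subst sum.swap) (simp add: sum_distrib_left risk_eq_sum_coord_risk[OF fhat])
  also have "\<dots> \<le> (\<Sum>S\<in>Pow \<Lambda>. ennreal (w S) * max_risk \<Lambda> \<sigma> \<gamma> fhat)"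
  proof (intro sum_mono)
    fix S assume S: "S \<in> Pow \<Lambda>"
    show "ennreal (w S) * risk \<Lambda> \<sigma> fhat (spikes \<Lambda> m S) \<le> ennreal (w S) * max_risk \<Lambda> \<sigma> \<gamma> fhat"
    proof (cases "real (card S) \<le> real (card \<Lambda>) * \<gamma>")
      case True
      then have "spikes \<Lambda> m S \<in> sparse_class \<Lambda> \<gamma>"
        using assms(1) S by (intro spikes_in_sparse_class) auto
      then show ?thesis
        unfolding max_risk_def by (intro mult_left_mono SUP_upper) auto
    qed (simp add: w_def)
  qed
  also have "\<dots> = ennreal (\<Sum>S\<in>Pow \<Lambda>. w S) * max_risk \<Lambda> \<sigma> \<gamma> fhat"
    using sum_ennreal[of "Pow \<Lambda>" w] w by (simp flip: sum_distrib_right)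
  also have "\<dots> \<le> 1 * max_risk \<Lambda> \<sigma> \<gamma> fhat"
  proof (intro mult_right_mono)
    have "(\<Sum>S\<in>Pow \<Lambda>. w S) \<le> (\<Sum>S\<in>Pow \<Lambda>. subset_prob \<Lambda> \<alpha> S)"
      by (intro sum_mono w)
    then show "ennreal (\<Sum>S\<in>Pow \<Lambda>. w S) \<le> 1"
      using sum_subset_prob[OF assms(1), of \<alpha>] by simp
  qed simp
  finally show ?thesis by (simp add: w_def)
qed

text \<open>
The threshold \<open>c0\<close> on the spike probabilities depends on \<open>\<epsilon>\<close> only; the model, the sparsity level and
the estimator are arbitrary.
\<close>

lemma max_risk_ge_entropy_sum:
  assumes "0 < \<epsilon>" "\<epsilon> < 1"
  obtains c0 where "0 < c0" "c0 < 1"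
    "\<And>(\<Lambda> :: 'i set) \<sigma> \<gamma> fhat \<alpha> s.
      \<lbrakk>finite \<Lambda>; \<And>l. l \<in> \<Lambda> \<Longrightarrow> 0 < \<sigma> l; fhat \<in> estimators \<Lambda>;
       \<And>l. l \<in> \<Lambda> \<Longrightarrow> 0 \<le> \<alpha> l \<and> \<alpha> l \<le> c0; (\<Sum>l\<in>\<Lambda>. \<alpha> l) \<le> s; s < real (card \<Lambda>) * \<gamma> - 1\<rbrakk>
      \<Longrightarrow> ennreal ((1 - s / (real (card \<Lambda>) * \<gamma> - 1 - s)\<^sup>2) * (1 - \<epsilon>)
              * (2 * (\<Sum>l\<in>\<Lambda>. (\<sigma> l)\<^sup>2 * \<alpha> l * ln (inverse (\<alpha> l)))))
          \<le> max_risk \<Lambda> \<sigma> \<gamma> fhat"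
proof -
  obtain c0 where c0: "0 < c0" "c0 < 1" and
    bound: "\<And>a. 0 < a \<Longrightarrow> a \<le> c0 \<Longrightarrow>
       \<exists>\<mu> t. 0 \<le> \<mu> \<and> 0 < t \<and> (1 - \<epsilon>) * (2 * a * ln (inverse a)) \<le> spike_risk_bound \<mu> t a"
    using spike_risk_bound_exists[OF assms(1)] by metis
  show thesis
  proof (rule that[OF c0])
    fix \<Lambda> :: "'i set" and \<sigma> \<alpha> :: "'i \<Rightarrow> real" and fhat and \<gamma> s :: real
    assume fin: "finite \<Lambda>" and \<sigma>: "\<And>l. l \<in> \<Lambda> \<Longrightarrow> 0 < \<sigma> l" and fhat: "fhat \<in> estimators \<Lambda>"
      and \<alpha>: "\<And>l. l \<in> \<Lambda> \<Longrightarrow> 0 \<le> \<alpha> l \<and> \<alpha> l \<le> c0"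
      and s: "(\<Sum>l\<in>\<Lambda>. \<alpha> l) \<le> s" "s < real (card \<Lambda>) * \<gamma> - 1"
    define R where "R = real (card \<Lambda>) * \<gamma>"
    define p where "p = 1 - s / (R - 1 - s)\<^sup>2"
    define b where "b l = (1 - \<epsilon>) * (2 * \<alpha> l * ln (inverse (\<alpha> l)))" for l
    have b: "0 \<le> b l" if "l \<in> \<Lambda>" for l
    proof (cases "\<alpha> l = 0")
      case False
      then have "0 < \<alpha> l" "\<alpha> l \<le> 1" using \<alpha>[OF that] c0 by auto
      then show ?thesis using assms by (simp add: b_def ln_inverse mult_nonneg_nonpos)
    qed (simp add: b_def)
    have "\<forall>l\<in>\<Lambda>. \<exists>\<mu> t. 0 < \<alpha> l \<longrightarrow> 0 \<le> \<mu> \<and> 0 < t \<and> b l \<le> spike_risk_bound \<mu> t (\<alpha> l)"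
      using bound \<alpha> unfolding b_def by meson
    then obtain \<mu> t where \<mu>t: "\<And>l. l \<in> \<Lambda> \<Longrightarrow> 0 < \<alpha> l \<Longrightarrow>
        0 \<le> \<mu> l \<and> 0 < t l \<and> b l \<le> spike_risk_bound (\<mu> l) (t l) (\<alpha> l)"
      by metis
    define m where "m l = \<sigma> l * \<mu> l" for l
    define B where "B l = (\<Sum>S\<in>Pow \<Lambda>. ennreal (of_bool (real (card S) \<le> R) * subset_prob \<Lambda> \<alpha> S)
          * coord_risk \<Lambda> \<sigma> fhat (spikes \<Lambda> m S) l)" for l
    have coord: "ennreal (p * ((\<sigma> l)\<^sup>2 * b l)) \<le> B l" if l: "l \<in> \<Lambda>" for l
    proof (cases "\<alpha> l = 0")
      case False
      then have "0 < \<alpha> l" using \<alpha>[OF l] by simp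
      have \<alpha>1: "0 \<le> \<alpha> k \<and> \<alpha> k < 1" if "k \<in> \<Lambda>" for k using \<alpha>[OF that] c0 by auto
      show ?thesis
        unfolding p_def B_def
        using \<mu>t[OF l \<open>0 < \<alpha> l\<close>] b[OF l] s \<open>0 < \<alpha> l\<close>
        by (intro truncated_Bayes_coord_risk[where t = "t l" and \<mu> = "\<mu> l"] fin l \<sigma> fhat \<alpha>1)
          (auto simp: m_def R_def)
    qed (simp add: b_def)
    \<comment> \<open>If the Chebyshev bound \<open>p\<close> is negative, it carries no information and neither does the claim.\<close>
    have "ennreal (p * (\<Sum>l\<in>\<Lambda>. (\<sigma> l)\<^sup>2 * b l)) \<le> (\<Sum>l\<in>\<Lambda>. B l)"
    proof (cases "0 \<le> p")
      case True
      then have "ennreal (p * (\<Sum>l\<in>\<Lambda>. (\<sigma> l)\<^sup>2 * b l)) = (\<Sum>l\<in>\<Lambda>. ennreal (p * ((\<sigma> l)\<^sup>2 * b l)))"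
        using b by (simp add: sum_distrib_left sum_ennreal)
      then show ?thesis using coord by (simp add: sum_mono)
    next
      case False
      then have "p * (\<Sum>l\<in>\<Lambda>. (\<sigma> l)\<^sup>2 * b l) \<le> 0"
        using b by (intro mult_nonpos_nonneg sum_nonneg) auto
      then show ?thesis by (simp add: ennreal_neg)
    qed
    also have "\<dots> \<le> max_risk \<Lambda> \<sigma> \<gamma> fhat"
      unfolding B_def R_def using \<alpha> c0
      by (intro max_risk_ge_truncated_Bayes_risk fin fhat) (meson order.strict_implies_order order.trans)
    finally have "ennreal (p * (\<Sum>l\<in>\<Lambda>. (\<sigma> l)\<^sup>2 * b l)) \<le> max_risk \<Lambda> \<sigma> \<gamma> fhat" .
    then show "ennreal ((1 - s / (real (card \<Lambda>) * \<gamma> - 1 - s)\<^sup>2) * (1 - \<epsilon>)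
              * (2 * (\<Sum>l\<in>\<Lambda>. (\<sigma> l)\<^sup>2 * \<alpha> l * ln (inverse (\<alpha> l))))) \<le> max_risk \<Lambda> \<sigma> \<gamma> fhat"
      by (simp add: p_def R_def b_def sum_distrib_left mult_ac)
  qed
qed

section \<open>Bounds over sets of weights\<close>

text \<open>
Turns eventual statements, one for each \<open>k\<close>, into a single one with \<open>k\<close> growing slowly: \<open>\<kappa> n\<close>
is the largest \<open>k \<le> n\<close> whose statement has become valid by \<open>n\<close>.
\<close>

lemma diagonal_sequence:
  fixes P :: "nat \<Rightarrow> nat \<Rightarrow> bool"
  assumes "\<And>k. \<forall>\<^sub>F n in sequentially. P k n"
  obtains \<kappa> where "filterlim \<kappa> at_top sequentially" "\<forall>\<^sub>F n in sequentially. P (\<kappa> n) n"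
proof -
  from assms obtain N where N: "\<And>k n. N k \<le> n \<Longrightarrow> P k n"
    unfolding eventually_sequentially by metis
  define \<kappa> where "\<kappa> n = Max {k. k \<le> n \<and> N k \<le> n}" for n
  \<comment> \<open>For \<open>n < N 0\<close> the set in the definition of \<open>\<kappa> n\<close> may be empty.\<close>
  have "P (\<kappa> n) n" if "N 0 \<le> n" for n
  proof -
    have "\<kappa> n \<in> {k. k \<le> n \<and> N k \<le> n}"
      unfolding \<kappa>_def by (rule Max_in) (use that in auto)
    then show ?thesis using N by simp
  qed
  then have "\<forall>\<^sub>F n in sequentially. P (\<kappa> n) n"
    unfolding eventually_sequentially by blast
  moreover have "filterlim \<kappa> at_top sequentially"
    unfolding filterlim_at_top eventually_sequentially
  proof
    fix k
    have "k \<le> \<kappa> n" if "max k (N k) \<le> n" for n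
      unfolding \<kappa>_def by (rule Max_ge) (use that in auto)
    then show "\<exists>M. \<forall>n\<ge>M. k \<le> \<kappa> n" by blast
  qed
  ultimately show thesis by (rule that[rotated])
qed

text \<open>
A bound that loses an arbitrary factor \<open>1 - \<epsilon>\<close> holds with a factor \<open>1 + \<delta> n\<close> where \<open>\<delta>\<close> vanishes.
\<close>

lemma vanishing_sequence:
  fixes P :: "real \<Rightarrow> nat \<Rightarrow> bool"
  assumes "\<And>\<epsilon>. 0 < \<epsilon> \<Longrightarrow> \<epsilon> < 1 \<Longrightarrow> \<forall>\<^sub>F n in sequentially. P \<epsilon> n"
  shows "\<exists>\<delta>. \<delta> \<longlonglongrightarrow> 0 \<and> (\<forall>\<^sub>F n in sequentially. P (- \<delta> n) n)"
proof -
  have "\<forall>\<^sub>F n in sequentially. P (1 / real (k + 2)) n" for k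
    by (intro assms) simp_all
  then obtain \<kappa> where \<kappa>: "filterlim \<kappa> at_top sequentially"
    and P: "\<forall>\<^sub>F n in sequentially. P (1 / real (\<kappa> n + 2)) n"
    by (rule diagonal_sequence)
  have "(\<lambda>k. - (1 / real (k + 2))) \<longlonglongrightarrow> 0" by real_asymp
  from filterlim_compose[OF this \<kappa>] P show ?thesis
    by (intro exI[of _ "\<lambda>n. - (1 / real (\<kappa> n + 2))"]) simp
qed

lemma eventually_few_excess_spikes:
  fixes c \<epsilon> :: real
  assumes "0 < c" "0 < \<epsilon>"
  shows "\<forall>\<^sub>F R in at_top. R * (1 - c) < R - 1 \<and> R * (1 - c) / (R - 1 - R * (1 - c))\<^sup>2 < \<epsilon>"
proof (intro eventually_conj)
  show "\<forall>\<^sub>F R in at_top. R * (1 - c) < R - 1"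
    using assms by real_asymp
  have "((\<lambda>R. R * (1 - c) / (R * c - 1)\<^sup>2) \<longlongrightarrow> 0) at_top"
    using assms by real_asymp
  from order_tendstoD(2)[OF this assms(2)]
  show "\<forall>\<^sub>F R in at_top. R * (1 - c) / (R - 1 - R * (1 - c))\<^sup>2 < \<epsilon>"
    by (simp add: algebra_simps)
qed

text \<open>
For fixed \<open>c\<close> the slack between the bound \<open>R * (1 - c)\<close> on the expected number of spikes and the allowed number
\<open>R - 1\<close> is of order \<open>R\<close>, against a standard deviation of order at most \<open>sqrt R\<close>. The threshold on
\<open>R\<close> is uniform in the model, the estimator and the weights.
\<close>

lemma max_risk_ge_weight_set:
  assumes "0 < \<epsilon>" "\<epsilon> < 1"
  obtains c0 where "0 < c0" "c0 < 1"
    "\<And>c. \<lbrakk>0 < c; c \<le> c0\<rbrakk> \<Longrightarrow> \<forall>\<^sub>F R in at_top. \<forall>(\<Lambda> :: 'i set) \<sigma> \<gamma>. \<forall>fhat\<in>estimators \<Lambda>. \<forall>\<alpha>\<in>weight_set \<Lambda> R c.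
       finite \<Lambda> \<longrightarrow> (\<forall>l\<in>\<Lambda>. 0 < \<sigma> l) \<longrightarrow> real (card \<Lambda>) * \<gamma> = R \<longrightarrow>
       ennreal ((1 - \<epsilon>) * (2 * (\<Sum>l\<in>\<Lambda>. (\<sigma> l)\<^sup>2 * \<alpha> l * ln (inverse (\<alpha> l))))) \<le> max_risk \<Lambda> \<sigma> \<gamma> fhat"
proof -
  have \<epsilon>2: "0 < \<epsilon> / 2" "\<epsilon> / 2 < 1" using assms by simp_all
  obtain c0 where c0: "0 < c0" "c0 < 1" and
    bound: "\<And>(\<Lambda> :: 'i set) \<sigma> \<gamma> fhat \<alpha> s.
      \<lbrakk>finite \<Lambda>; \<And>l. l \<in> \<Lambda> \<Longrightarrow> 0 < \<sigma> l; fhat \<in> estimators \<Lambda>;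
       \<And>l. l \<in> \<Lambda> \<Longrightarrow> 0 \<le> \<alpha> l \<and> \<alpha> l \<le> c0; (\<Sum>l\<in>\<Lambda>. \<alpha> l) \<le> s; s < real (card \<Lambda>) * \<gamma> - 1\<rbrakk>
      \<Longrightarrow> ennreal ((1 - s / (real (card \<Lambda>) * \<gamma> - 1 - s)\<^sup>2) * (1 - \<epsilon> / 2)
              * (2 * (\<Sum>l\<in>\<Lambda>. (\<sigma> l)\<^sup>2 * \<alpha> l * ln (inverse (\<alpha> l)))))
          \<le> max_risk \<Lambda> \<sigma> \<gamma> fhat"
    by (rule max_risk_ge_entropy_sum[OF \<epsilon>2, where 'i = 'i]) blast
  show thesis
  proof (rule that[OF c0])
    fix c :: real assume c: "0 < c" "c \<le> c0"
    have main: "ennreal ((1 - \<epsilon>) * (2 * (\<Sum>l\<in>\<Lambda>. (\<sigma> l)\<^sup>2 * \<alpha> l * ln (inverse (\<alpha> l))))) \<le> max_risk \<Lambda> \<sigma> \<gamma> fhat"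
      if R: "R * (1 - c) < R - 1" "R * (1 - c) / (R - 1 - R * (1 - c))\<^sup>2 < \<epsilon> / 2"
        and fhat: "fhat \<in> estimators \<Lambda>" and \<alpha>: "\<alpha> \<in> weight_set \<Lambda> R c"
        and fin: "finite \<Lambda>" and \<sigma>: "\<forall>l\<in>\<Lambda>. 0 < \<sigma> l" and R_eq: "real (card \<Lambda>) * \<gamma> = R"
      for R \<gamma> :: real and \<Lambda> :: "'i set" and \<sigma> \<alpha> :: "'i \<Rightarrow> real" and fhat
    proof -
      define H where "H = 2 * (\<Sum>l\<in>\<Lambda>. (\<sigma> l)\<^sup>2 * \<alpha> l * ln (inverse (\<alpha> l)))"
      define p where "p = 1 - R * (1 - c) / (R - 1 - R * (1 - c))\<^sup>2"
      have \<alpha>': "0 \<le> \<alpha> l" "\<alpha> l \<le> c" if "l \<in> \<Lambda>" for l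
        using \<alpha> that by (auto simp: weight_set_def PiE_iff)
      have "0 \<le> (\<sigma> l)\<^sup>2 * \<alpha> l * ln (inverse (\<alpha> l))" if "l \<in> \<Lambda>" for l
      proof (cases "\<alpha> l = 0")
        case False
        then have "0 < \<alpha> l" "\<alpha> l \<le> 1" using \<alpha>'[OF that] c c0 by auto
        then show ?thesis by (simp add: ln_inverse mult_nonneg_nonpos)
      qed simp
      then have H: "0 \<le> H" unfolding H_def by (simp add: sum_nonneg)
      have "1 - \<epsilon> \<le> (1 - \<epsilon> / 2) * (1 - \<epsilon> / 2)" by (simp add: algebra_simps)
      also have "\<dots> \<le> p * (1 - \<epsilon> / 2)"
        using R(2) assms by (intro mult_right_mono) (simp_all add: p_def)
      finally have "(1 - \<epsilon>) * H \<le> p * (1 - \<epsilon> / 2) * H"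
        using H by (intro mult_right_mono)
      then have "ennreal ((1 - \<epsilon>) * H) \<le> ennreal (p * (1 - \<epsilon> / 2) * H)"
        by (rule ennreal_leI)
      also have "\<dots> \<le> max_risk \<Lambda> \<sigma> \<gamma> fhat"
      proof -
        have "0 \<le> \<alpha> l \<and> \<alpha> l \<le> c0" if "l \<in> \<Lambda>" for l
          using \<alpha>'[OF that] c by simp
        moreover have "(\<Sum>l\<in>\<Lambda>. \<alpha> l) \<le> R * (1 - c)"
          using \<alpha> by (simp add: weight_set_def)
        ultimately show ?thesis
          using bound[OF fin _ fhat, of \<sigma> \<alpha> "R * (1 - c)" \<gamma>] \<sigma> R(1)
          by (simp add: R_eq p_def H_def)
      qed
      finally show ?thesis by (simp add: H_def)
    qed
    show "\<forall>\<^sub>F R in at_top. \<forall>(\<Lambda> :: 'i set) \<sigma> \<gamma>. \<forall>fhat\<in>estimators \<Lambda>. \<forall>\<alpha>\<in>weight_set \<Lambda> R c.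
       finite \<Lambda> \<longrightarrow> (\<forall>l\<in>\<Lambda>. 0 < \<sigma> l) \<longrightarrow> real (card \<Lambda>) * \<gamma> = R \<longrightarrow>
       ennreal ((1 - \<epsilon>) * (2 * (\<Sum>l\<in>\<Lambda>. (\<sigma> l)\<^sup>2 * \<alpha> l * ln (inverse (\<alpha> l))))) \<le> max_risk \<Lambda> \<sigma> \<gamma> fhat"
      using eventually_few_excess_spikes[OF c(1) \<epsilon>2(1)]
      by (rule eventually_mono) (use main in blast)
  qed
qed

text \<open>
One diagonal sequence serves both \<open>\<epsilon> = 1 / (k + 2)\<close> and the corresponding level \<open>c k \<le> \<epsilon>\<close>, so
\<open>c\<close> and \<open>\<delta>\<close> vanish together.
\<close>

lemma max_risk_ge_SUP_weight_set:
  fixes \<Lambda> :: "nat \<Rightarrow> 'i set" and \<sigma> :: "nat \<Rightarrow> 'i \<Rightarrow> real" and \<gamma> :: "nat \<Rightarrow> real"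
  assumes fin: "\<And>n. finite (\<Lambda> n)" and card: "\<And>n. card (\<Lambda> n) = n"
    and \<sigma>: "\<And>n l. l \<in> \<Lambda> n \<Longrightarrow> \<sigma> n l > 0"
    and n\<gamma>: "filterlim (\<lambda>n. real n * \<gamma> n) at_top sequentially"
  shows "\<exists>c \<delta>. (\<forall>n. 0 < c n \<and> c n < 1) \<and> c \<longlonglongrightarrow> (0::real) \<and> \<delta> \<longlonglongrightarrow> (0::real) \<and>
            (\<forall>\<^sub>F n in sequentially. \<forall>fhat\<in>estimators (\<Lambda> n).
               max_risk (\<Lambda> n) (\<sigma> n) (\<gamma> n) fhat \<ge>
                 (SUP \<alpha>\<in>weight_set (\<Lambda> n) (real n * \<gamma> n) (c n).
                    ennreal (2 * (1 + \<delta> n) *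
                      (\<Sum>l\<in>\<Lambda> n. (\<sigma> n l)\<^sup>2 * \<alpha> l * ln (inverse (\<alpha> l))))))"
proof -
  define P where "P \<epsilon> c n \<longleftrightarrow> (\<forall>fhat\<in>estimators (\<Lambda> n). \<forall>\<alpha>\<in>weight_set (\<Lambda> n) (real n * \<gamma> n) c.
      ennreal ((1 - \<epsilon>) * (2 * (\<Sum>l\<in>\<Lambda> n. (\<sigma> n l)\<^sup>2 * \<alpha> l * ln (inverse (\<alpha> l)))))
        \<le> max_risk (\<Lambda> n) (\<sigma> n) (\<gamma> n) fhat)" for \<epsilon> c n
  have "\<exists>c>0. c \<le> \<epsilon> \<and> (\<forall>\<^sub>F n in sequentially. P \<epsilon> c n)" if \<epsilon>: "0 < \<epsilon>" "\<epsilon> < 1" for \<epsilon>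
  proof -
    obtain c0 where c0: "0 < c0" "c0 < 1" and bound:
      "\<And>c. \<lbrakk>0 < c; c \<le> c0\<rbrakk> \<Longrightarrow> \<forall>\<^sub>F R in at_top. \<forall>(\<Lambda> :: 'i set) \<sigma> \<gamma>. \<forall>fhat\<in>estimators \<Lambda>. \<forall>\<alpha>\<in>weight_set \<Lambda> R c.
         finite \<Lambda> \<longrightarrow> (\<forall>l\<in>\<Lambda>. 0 < \<sigma> l) \<longrightarrow> real (card \<Lambda>) * \<gamma> = R \<longrightarrow>
         ennreal ((1 - \<epsilon>) * (2 * (\<Sum>l\<in>\<Lambda>. (\<sigma> l)\<^sup>2 * \<alpha> l * ln (inverse (\<alpha> l))))) \<le> max_risk \<Lambda> \<sigma> \<gamma> fhat"
      by (rule max_risk_ge_weight_set[OF \<epsilon>, where 'i = 'i]) blast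
    have c: "0 < min c0 \<epsilon>" "min c0 \<epsilon> \<le> c0" using c0 \<epsilon> by simp_all
    have "\<forall>\<^sub>F n in sequentially. P \<epsilon> (min c0 \<epsilon>) n"
      using eventually_compose_filterlim[OF bound[OF c] n\<gamma>]
      by (rule eventually_mono) (simp add: P_def fin card \<sigma>)
    then show ?thesis using c by (intro exI[of _ "min c0 \<epsilon>"]) simp
  qed
  then have "\<exists>c>0. c \<le> 1 / real (k + 2) \<and> (\<forall>\<^sub>F n in sequentially. P (1 / real (k + 2)) c n)" for k
    by simp
  then obtain c where c: "\<And>k. 0 < c k" "\<And>k. c k \<le> 1 / real (k + 2)"
    and ev: "\<And>k. \<forall>\<^sub>F n in sequentially. P (1 / real (k + 2)) (c k) n"
    by metis
  from diagonal_sequence[of "\<lambda>k n. P (1 / real (k + 2)) (c k) n", OF ev] obtain \<kappa> where \<kappa>: "filterlim \<kappa> at_top sequentially"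
    and P: "\<forall>\<^sub>F n in sequentially. P (1 / real (\<kappa> n + 2)) (c (\<kappa> n)) n"
    by blast
  have lim: "(\<lambda>k. 1 / real (k + 2)) \<longlonglongrightarrow> 0" by real_asymp
  have "c \<longlonglongrightarrow> 0"
    by (intro tendsto_sandwich[OF _ _ tendsto_const lim] always_eventually allI less_imp_le[OF c(1)] c(2))
  then have "(\<lambda>n. c (\<kappa> n)) \<longlonglongrightarrow> 0"
    using \<kappa> by (rule filterlim_compose)
  moreover have "(\<lambda>n. - (1 / real (\<kappa> n + 2))) \<longlonglongrightarrow> 0"
    using tendsto_minus[OF filterlim_compose[OF lim \<kappa>]] by simp
  moreover have "c (\<kappa> n) < 1" for n
    by (rule le_less_trans[OF c(2)]) simp
  moreover have "\<forall>\<^sub>F n in sequentially. \<forall>fhat\<in>estimators (\<Lambda> n).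
               max_risk (\<Lambda> n) (\<sigma> n) (\<gamma> n) fhat \<ge>
                 (SUP \<alpha>\<in>weight_set (\<Lambda> n) (real n * \<gamma> n) (c (\<kappa> n)).
                    ennreal (2 * (1 + - (1 / real (\<kappa> n + 2))) *
                      (\<Sum>l\<in>\<Lambda> n. (\<sigma> n l)\<^sup>2 * \<alpha> l * ln (inverse (\<alpha> l)))))"
    using P
  proof eventually_elim
    case (elim n)
    show ?case
    proof (intro ballI SUP_least)
      fix fhat \<alpha> assume "fhat \<in> estimators (\<Lambda> n)" "\<alpha> \<in> weight_set (\<Lambda> n) (real n * \<gamma> n) (c (\<kappa> n))"
      with elim show "ennreal (2 * (1 + - (1 / real (\<kappa> n + 2))) *
          (\<Sum>l\<in>\<Lambda> n. (\<sigma> n l)\<^sup>2 * \<alpha> l * ln (inverse (\<alpha> l)))) \<le> max_risk (\<Lambda> n) (\<sigma> n) (\<gamma> n) fhat"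
        unfolding P_def by (simp only: mult_ac add_uminus_conv_diff)
    qed
  qed
  ultimately show ?thesis
    using c(1) by (intro exI[of _ "\<lambda>n. c (\<kappa> n)"] exI[of _ "\<lambda>n. - (1 / real (\<kappa> n + 2))"]) simp
qed

section \<open>Ordered variances\<close>

lemma var_desc_enumeration:
  assumes "finite \<Lambda>"
  obtains zs where "distinct zs" "set zs = \<Lambda>" "length zs = card \<Lambda>" "sorted (rev (map (\<lambda>l. (\<sigma> l)\<^sup>2) zs))"
    "\<And>i. 1 \<le> i \<Longrightarrow> i \<le> card \<Lambda> \<Longrightarrow> var_desc \<Lambda> \<sigma> i = map (\<lambda>l. (\<sigma> l)\<^sup>2) zs ! (i - 1)"
proof -
  let ?v = "\<lambda>l. (\<sigma> l)\<^sup>2"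
  obtain ks where ks: "distinct ks" "set ks = \<Lambda>"
    using finite_distinct_list[OF assms] by blast
  define zs where "zs = rev (sort_key ?v ks)"
  have "image_mset ?v (mset_set \<Lambda>) = mset (map ?v (sort_key ?v ks))"
    using ks by (simp add: mset_set_set[symmetric])
  then have "sorted_list_of_multiset (image_mset ?v (mset_set \<Lambda>)) = rev (map ?v zs)"
    by (simp add: zs_def rev_map sorted_sort_id del: mset_map)
  then show thesis
    using ks distinct_card[OF ks(1)]
    by (intro that[of zs]) (auto simp: zs_def rev_map var_desc_def)
qed

lemma var_desc_antimono:
  assumes "finite \<Lambda>" "1 \<le> i" "i \<le> j" "j \<le> card \<Lambda>"
  shows "var_desc \<Lambda> \<sigma> j \<le> var_desc \<Lambda> \<sigma> i"
proof -
  from var_desc_enumeration[OF assms(1), of \<sigma>] obtain zs where zs: "length zs = card \<Lambda>"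
    "sorted (rev (map (\<lambda>l. (\<sigma> l)\<^sup>2) zs))"
    "\<And>i. 1 \<le> i \<Longrightarrow> i \<le> card \<Lambda> \<Longrightarrow> var_desc \<Lambda> \<sigma> i = map (\<lambda>l. (\<sigma> l)\<^sup>2) zs ! (i - 1)"
    by metis
  show ?thesis
    using sorted_rev_nth_mono[OF zs(2), of "i - 1" "j - 1"] zs(1,3) assms by simp
qed

lemma max_var_le_var_desc_1:
  assumes "finite \<Lambda>" "\<Lambda> \<noteq> {}"
  shows "max_var \<Lambda> \<sigma> \<le> var_desc \<Lambda> \<sigma> 1"
proof -
  from var_desc_enumeration[OF assms(1), of \<sigma>] obtain zs where zs: "set zs = \<Lambda>" "length zs = card \<Lambda>"
    "sorted (rev (map (\<lambda>l. (\<sigma> l)\<^sup>2) zs))"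
    "\<And>i. 1 \<le> i \<Longrightarrow> i \<le> card \<Lambda> \<Longrightarrow> var_desc \<Lambda> \<sigma> i = map (\<lambda>l. (\<sigma> l)\<^sup>2) zs ! (i - 1)"
    by metis
  have "(\<sigma> l)\<^sup>2 \<le> var_desc \<Lambda> \<sigma> 1" if "l \<in> \<Lambda>" for l
  proof -
    obtain j where j: "j < length zs" "zs ! j = l"
      using \<open>l \<in> \<Lambda>\<close> zs(1) by (auto simp: in_set_conv_nth)
    then have "(\<sigma> l)\<^sup>2 = var_desc \<Lambda> \<sigma> (j + 1)" using zs by simp
    also have "\<dots> \<le> var_desc \<Lambda> \<sigma> 1"
      using j zs(2) assms by (intro var_desc_antimono) simp_all
    finally show ?thesis .
  qed
  then show ?thesis using assms by (simp add: max_var_def)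
qed

lemma max_var_nonneg:
  assumes "finite \<Lambda>" "\<Lambda> \<noteq> {}"
  shows "0 \<le> max_var \<Lambda> \<sigma>"
proof -
  from assms(2) obtain l where "l \<in> \<Lambda>" by blast
  then have "(\<sigma> l)\<^sup>2 \<le> max_var \<Lambda> \<sigma>"
    unfolding max_var_def using assms(1) by (intro Max_ge) auto
  then show ?thesis by (rule order_trans[rotated]) simp
qed

lemma top_variances_subset:
  assumes "finite \<Lambda>" "r \<le> card \<Lambda>"
  obtains J where "J \<subseteq> \<Lambda>" "card J = r" "(\<Sum>l\<in>J. (\<sigma> l)\<^sup>2) = (\<Sum>i=1..r. var_desc \<Lambda> \<sigma> i)"
proof -
  let ?v = "\<lambda>l. (\<sigma> l)\<^sup>2"
  from var_desc_enumeration[OF assms(1), of \<sigma>] obtain zs where zs: "distinct zs" "set zs = \<Lambda>"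
    "length zs = card \<Lambda>"
    "\<And>i. 1 \<le> i \<Longrightarrow> i \<le> card \<Lambda> \<Longrightarrow> var_desc \<Lambda> \<sigma> i = map ?v zs ! (i - 1)"
    by metis
  show thesis
  proof
    show "set (take r zs) \<subseteq> \<Lambda>" using zs(2) by (metis set_take_subset)
    show "card (set (take r zs)) = r"
      using zs assms by (simp add: distinct_card)
    have "(\<Sum>i=1..r. var_desc \<Lambda> \<sigma> i) = (\<Sum>i=1..r. ?v (zs ! (i - 1)))"
      using zs(3,4) assms by (intro sum.cong) auto
    also have "\<dots> = (\<Sum>i<r. ?v (zs ! i))"
      by (simp add: sum.atLeast1_atMost_eq)
    also have "\<dots> = sum_list (map ?v (take r zs))"
      using zs(3) assms by (simp add: sum_list_sum_nth atLeast0LessThan)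
    also have "\<dots> = (\<Sum>l\<in>set (take r zs). ?v l)"
      using zs(1) by (simp add: sum_list_distinct_conv_sum_set)
    finally show "(\<Sum>l\<in>set (take r zs). ?v l) = (\<Sum>i=1..r. var_desc \<Lambda> \<sigma> i)" by simp
  qed
qed

section \<open>The coordinates of largest variance\<close>

lemma ln_inverse_at_top:
  fixes \<gamma> :: "nat \<Rightarrow> real"
  assumes "\<gamma> \<longlonglongrightarrow> 0" "\<And>n. n \<ge> 1 \<Longrightarrow> 0 < \<gamma> n"
  shows "filterlim (\<lambda>n. ln (inverse (\<gamma> n))) at_top sequentially"
proof -
  have "filterlim \<gamma> (at_right 0) sequentially"
    unfolding filterlim_at
    using assms(1) by (auto intro!: eventually_sequentiallyI[of 1] dest: assms(2))
  moreover have "filterlim (\<lambda>x::real. ln (inverse x)) at_top (at_right 0)"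
    by real_asymp
  ultimately show ?thesis
    by (rule filterlim_compose[rotated])
qed

text \<open>
The weight \<open>a = n * \<gamma> n * (1 - c) / r n\<close> on each of the \<open>r n\<close> largest variances exhausts the budget
\<open>n * \<gamma> n * (1 - c)\<close>. Up to the additive constant \<open>- ln (1 - c)\<close>, \<open>ln (1 / a)\<close> is
\<open>ln (1 / \<gamma> n) - ln (n / r n)\<close>, where the second term is negligible; in particular \<open>a\<close> tends to
zero and eventually respects the cap \<open>c\<close>.
\<close>

lemma max_risk_ge_top_variances:
  fixes \<Lambda> :: "nat \<Rightarrow> 'i set" and \<sigma> :: "nat \<Rightarrow> 'i \<Rightarrow> real" and \<gamma> :: "nat \<Rightarrow> real" and r :: "nat \<Rightarrow> nat"
  assumes fin: "\<And>n. finite (\<Lambda> n)" and card: "\<And>n. card (\<Lambda> n) = n"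
    and \<sigma>: "\<And>n l. l \<in> \<Lambda> n \<Longrightarrow> \<sigma> n l > 0"
    and \<gamma>: "\<And>n. n \<ge> 1 \<Longrightarrow> 0 < \<gamma> n \<and> \<gamma> n < 1"
    and \<gamma>0: "\<gamma> \<longlonglongrightarrow> 0"
    and n\<gamma>: "filterlim (\<lambda>n. real n * \<gamma> n) at_top sequentially"
    and r: "\<And>n. n \<ge> 1 \<Longrightarrow> 1 \<le> r n \<and> r n \<le> n"
    and r_o: "(\<lambda>n. ln (real n / real (r n))) \<in> o(\<lambda>n. ln (inverse (\<gamma> n)))"
    and \<epsilon>: "0 < \<epsilon>" "\<epsilon> < 1"
  shows "\<forall>\<^sub>F n in sequentially. \<forall>fhat\<in>estimators (\<Lambda> n).
     ennreal ((1 - \<epsilon>) * (2 * real n * \<gamma> n * ln (inverse (\<gamma> n)) *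
                   (1 / real (r n) * (\<Sum>i=1..r n. var_desc (\<Lambda> n) (\<sigma> n) i))))
       \<le> max_risk (\<Lambda> n) (\<sigma> n) (\<gamma> n) fhat"
proof -
  \<comment> \<open>Three losses of a factor \<open>1 - e\<close>: in the bound for weight sets, in the budget, in the logarithm.\<close>
  define e where "e = \<epsilon> / 3"
  have e: "0 < e" "e < 1" using \<epsilon> by (simp_all add: e_def)
  define L where "L n = ln (inverse (\<gamma> n))" for n
  obtain c0 where c0: "0 < c0" "c0 < 1" and bound:
    "\<And>c. \<lbrakk>0 < c; c \<le> c0\<rbrakk> \<Longrightarrow> \<forall>\<^sub>F R in at_top. \<forall>(\<Lambda> :: 'i set) \<sigma> \<gamma>. \<forall>fhat\<in>estimators \<Lambda>. \<forall>\<alpha>\<in>weight_set \<Lambda> R c.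
       finite \<Lambda> \<longrightarrow> (\<forall>l\<in>\<Lambda>. 0 < \<sigma> l) \<longrightarrow> real (card \<Lambda>) * \<gamma> = R \<longrightarrow>
       ennreal ((1 - e) * (2 * (\<Sum>l\<in>\<Lambda>. (\<sigma> l)\<^sup>2 * \<alpha> l * ln (inverse (\<alpha> l))))) \<le> max_risk \<Lambda> \<sigma> \<gamma> fhat"
    by (rule max_risk_ge_weight_set[OF e, where 'i = 'i]) blast
  define c where "c = min c0 e"
  have c: "0 < c" "c \<le> c0" "c \<le> e" "c < 1" using c0 e by (simp_all add: c_def)
  have L_top: "filterlim L at_top sequentially"
    unfolding L_def by (rule ln_inverse_at_top[OF \<gamma>0]) (use \<gamma> in blast)
  have ev1: "\<forall>\<^sub>F n in sequentially. norm (ln (real n / real (r n))) \<le> e * norm (L n)"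
    using landau_o.smallD[OF r_o e(1)] by (simp add: L_def)
  have ev2: "\<forall>\<^sub>F n in sequentially. - ln c / (1 - e) \<le> L n"
    using L_top by (auto simp: filterlim_at_top)
  have ev3: "\<forall>\<^sub>F n in sequentially. 0 < L n"
    using L_top by (auto simp: filterlim_at_top_dense)
  have ev4: "\<forall>\<^sub>F n in sequentially. \<forall>(\<Lambda> :: 'i set) \<sigma> \<gamma>'. \<forall>fhat\<in>estimators \<Lambda>. \<forall>\<alpha>\<in>weight_set \<Lambda> (real n * \<gamma> n) c.
       finite \<Lambda> \<longrightarrow> (\<forall>l\<in>\<Lambda>. 0 < \<sigma> l) \<longrightarrow> real (card \<Lambda>) * \<gamma>' = real n * \<gamma> n \<longrightarrow>
       ennreal ((1 - e) * (2 * (\<Sum>l\<in>\<Lambda>. (\<sigma> l)\<^sup>2 * \<alpha> l * ln (inverse (\<alpha> l))))) \<le> max_risk \<Lambda> \<sigma> \<gamma>' fhat"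
    using bound[OF c(1,2)] n\<gamma> by (rule eventually_compose_filterlim)
  show ?thesis
    using ev1 ev2 ev3 ev4 eventually_ge_at_top[of 1]
  proof eventually_elim
    case (elim n)
    have \<gamma>n: "0 < \<gamma> n" "\<gamma> n < 1" and rn: "1 \<le> r n" "r n \<le> n" using \<gamma> r elim(5) by auto
    obtain J where J: "J \<subseteq> \<Lambda> n" "card J = r n"
      and sumJ: "(\<Sum>l\<in>J. (\<sigma> n l)\<^sup>2) = (\<Sum>i=1..r n. var_desc (\<Lambda> n) (\<sigma> n) i)"
      using top_variances_subset[of "\<Lambda> n" "r n" "\<sigma> n"] fin card rn by auto
    have finJ: "finite J" using J(1) fin finite_subset by blast
    define V where "V = (\<Sum>i=1..r n. var_desc (\<Lambda> n) (\<sigma> n) i)"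
    have V: "0 \<le> V" unfolding V_def sumJ[symmetric] by (simp add: sum_nonneg)
    define a where "a = real n * \<gamma> n * (1 - c) / real (r n)"
    have a: "0 < a" using \<gamma>n rn c by (simp add: a_def)
    have ln_a: "(1 - e) * L n \<le> ln (inverse a)"
    proof -
      have "ln (inverse a) = L n - ln (real n / real (r n)) - ln (1 - c)"
        using \<gamma>n rn c by (simp add: a_def L_def ln_inverse ln_mult ln_div)
      moreover have "ln (real n / real (r n)) \<le> e * L n"
        using elim(1,3) by simp
      moreover have "ln (1 - c) \<le> 0" using c by simp
      ultimately show ?thesis by (simp add: algebra_simps)
    qed
    have "a \<le> c"
    proof -
      have "- ln c \<le> (1 - e) * L n"
        using iffD1[OF pos_divide_le_eq elim(2)] e by (simp add: mult.commute)
      with ln_a have "ln a \<le> ln c" using a by (simp add: ln_inverse)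
      then show ?thesis using a c by simp
    qed
    define \<alpha> where "\<alpha> = (\<lambda>l\<in>\<Lambda> n. if l \<in> J then a else 0)"
    have sum_on_J: "(\<Sum>l\<in>\<Lambda> n. if l \<in> J then g l else 0) = (\<Sum>l\<in>J. g l)" for g :: "'i \<Rightarrow> real"
      using J(1) fin by (simp add: sum.inter_restrict[symmetric] Int_absorb1)
    have "\<alpha> \<in> weight_set (\<Lambda> n) (real n * \<gamma> n) c"
    proof -
      have "(\<Sum>l\<in>\<Lambda> n. \<alpha> l) = (\<Sum>l\<in>J. a)"
        unfolding sum_on_J[symmetric] by (simp add: \<alpha>_def)
      also have "\<dots> = real n * \<gamma> n * (1 - c)"
        using J(2) rn by (simp add: a_def)
      finally show ?thesis
        using a \<open>a \<le> c\<close> c by (auto simp: weight_set_def \<alpha>_def)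
    qed
    then have risk: "ennreal ((1 - e) * (2 * (\<Sum>l\<in>\<Lambda> n. (\<sigma> n l)\<^sup>2 * \<alpha> l * ln (inverse (\<alpha> l)))))
        \<le> max_risk (\<Lambda> n) (\<sigma> n) (\<gamma> n) fhat" if "fhat \<in> estimators (\<Lambda> n)" for fhat
      using elim(4) that fin card \<sigma> by simp
    have H: "(\<Sum>l\<in>\<Lambda> n. (\<sigma> n l)\<^sup>2 * \<alpha> l * ln (inverse (\<alpha> l))) = V * (a * ln (inverse a))"
    proof -
      have "(\<Sum>l\<in>\<Lambda> n. (\<sigma> n l)\<^sup>2 * \<alpha> l * ln (inverse (\<alpha> l)))
        = (\<Sum>l\<in>\<Lambda> n. if l \<in> J then (\<sigma> n l)\<^sup>2 * (a * ln (inverse a)) else 0)"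
        by (intro sum.cong) (auto simp: \<alpha>_def)
      then show ?thesis
        unfolding V_def sumJ[symmetric] by (simp only: sum_on_J sum_distrib_right)
    qed
    have "(1 - \<epsilon>) * (2 * real n * \<gamma> n * L n * (1 / real (r n) * V))
        \<le> (1 - e) * (1 - e) * (1 - e) * (2 * real n * \<gamma> n * L n * (1 / real (r n) * V))"
    proof (intro mult_right_mono)
      \<comment> \<open>This is \<open>(1 - e) ^ 3 - (1 - 3 * e)\<close>.\<close>
      have "0 \<le> e * e * (3 - e)" using e by simp
      moreover have \<epsilon>_eq: "\<epsilon> = 3 * e" by (simp add: e_def)
      ultimately show "1 - \<epsilon> \<le> (1 - e) * (1 - e) * (1 - e)"
        by (simp add: \<epsilon>_eq algebra_simps)
      show "0 \<le> 2 * real n * \<gamma> n * L n * (1 / real (r n) * V)"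
        using \<gamma>n elim(3) V by simp
    qed
    also have "\<dots> = (1 - e) * (2 * (V * (real n * \<gamma> n * (1 - e) / real (r n) * ((1 - e) * L n))))"
      by (simp add: mult_ac)
    also have "\<dots> \<le> (1 - e) * (2 * (V * (a * ln (inverse a))))"
    proof (intro mult_left_mono mult_mono)
      show "real n * \<gamma> n * (1 - e) / real (r n) \<le> a"
        using c \<gamma>n by (auto simp: a_def intro!: divide_right_mono mult_left_mono)
    qed (use ln_a e V a elim(3) in auto)
    finally have "ennreal ((1 - \<epsilon>) * (2 * real n * \<gamma> n * L n * (1 / real (r n) * V)))
        \<le> ennreal ((1 - e) * (2 * (V * (a * ln (inverse a)))))"
      by (rule ennreal_leI)
    then show ?case
      using risk unfolding H L_def V_def by (blast intro: order_trans)
  qed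
qed

section \<open>Polynomial growth of the variances\<close>

text \<open>
The variance of rank \<open>\<eta> * n\<close> is about \<open>((1 - \<eta>) * n) powr \<beta>\<close>, and the largest one about
\<open>n powr \<beta>\<close>; their ratio tends to one as \<open>\<eta>\<close> tends to zero.
\<close>

lemma poly_growth_flat_top:
  fixes \<Lambda> :: "nat \<Rightarrow> 'i set"
  assumes fin: "\<And>n. finite (\<Lambda> n)" and card: "\<And>n. card (\<Lambda> n) = n"
    and growth: "poly_growth \<Lambda> \<sigma> \<beta>" and "0 < \<beta>" and "0 < \<epsilon>"
  obtains \<eta> where "0 < \<eta>" "\<eta> < 1"
    "\<forall>\<^sub>F n in sequentially. (1 - \<epsilon>) * max_var (\<Lambda> n) (\<sigma> n) \<le> var_desc (\<Lambda> n) (\<sigma> n) (nat \<lceil>\<eta> * real n\<rceil>)"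
proof -
  \<comment> \<open>A single parameter \<open>x\<close> is both the rank fraction \<open>\<eta>\<close> and the relative error in the growth
    assumption; \<open>2 * x\<close> instead of \<open>x\<close> absorbs the rounding of \<open>x * n\<close>.\<close>
  define h where "h x = (1 - x) / (1 + x) * (1 - 2 * x) powr \<beta>" for x :: real
  have "(h \<longlongrightarrow> 1) (at_right 0)"
    unfolding h_def by real_asymp
  from order_tendstoD(1)[OF this, of "1 - \<epsilon>"] \<open>0 < \<epsilon>\<close>
  have "\<forall>\<^sub>F x in at_right 0. 1 - \<epsilon> < h x" by simp
  moreover have "\<forall>\<^sub>F x in at_right 0. 0 < x \<and> x < (1 / 2 :: real)"
    by (auto simp: eventually_at_right_field intro: exI[of _ "1 / 2"])
  ultimately have "\<forall>\<^sub>F x in at_right 0. 1 - \<epsilon> < h x \<and> 0 < x \<and> x < (1 / 2 :: real)"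
    by eventually_elim simp
  then obtain x where x: "1 - \<epsilon> < h x" "0 < x" "x < 1 / 2"
    using eventually_happens trivial_limit_at_right_real by blast
  obtain M where M: "\<And>n i. 1 \<le> i \<Longrightarrow> i \<le> n \<Longrightarrow> M \<le> n - i \<Longrightarrow>
      \<bar>var_desc (\<Lambda> n) (\<sigma> n) i / real (n - i) powr \<beta> - 1\<bar> \<le> x"
    using growth x(2) unfolding poly_growth_def by meson
  have ev1: "\<forall>\<^sub>F n in sequentially. 1 \<le> x * real n"
    using x(2) by real_asymp
  have ev2: "\<forall>\<^sub>F n in sequentially. real M + 1 \<le> (1 - 2 * x) * real n"
  proof -
    have "filterlim (\<lambda>n. (1 - 2 * x) * real n) at_top sequentially"
      using x by (intro filterlim_tendsto_pos_mult_at_top[OF tendsto_const] filterlim_real_sequentially) simp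
    then show ?thesis by (auto simp: filterlim_at_top)
  qed
  have "\<forall>\<^sub>F n in sequentially. (1 - \<epsilon>) * max_var (\<Lambda> n) (\<sigma> n) \<le> var_desc (\<Lambda> n) (\<sigma> n) (nat \<lceil>x * real n\<rceil>)"
    using ev1 ev2
  proof eventually_elim
    case (elim n)
    define r where "r = nat \<lceil>x * real n\<rceil>"
    define v where "v = var_desc (\<Lambda> n) (\<sigma> n)"
    have r_le: "real r \<le> x * real n + 1"
      using elim(1) by (simp add: r_def)
    have "0 < r" using elim(1) by (simp add: r_def)
    have "(1 - 2 * x) * real n \<le> real n - real r"
      using r_le elim(1) by (simp add: algebra_simps)
    then have nr: "(1 - 2 * x) * real n \<le> real (n - r)" and "real r < real n"
      using elim(2) by linarith+
    then have "r < n" by simp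
    have "M + 1 \<le> n - r" using nr elim(2) by linarith
    with \<open>0 < r\<close> have "M \<le> n - 1" "2 \<le> n" by linarith+
    have v1: "v 1 \<le> (1 + x) * real n powr \<beta>"
    proof -
      have "v 1 / real (n - 1) powr \<beta> \<le> 1 + x"
        using M[of 1 n] \<open>M \<le> n - 1\<close> \<open>2 \<le> n\<close> unfolding v_def by force
      then have "v 1 \<le> (1 + x) * real (n - 1) powr \<beta>"
        using \<open>2 \<le> n\<close> by (simp add: pos_divide_le_eq)
      also have "\<dots> \<le> (1 + x) * real n powr \<beta>"
        using x \<open>0 < \<beta>\<close> by (intro mult_left_mono powr_mono2) simp_all
      finally show ?thesis .
    qed
    have vr: "(1 - x) * real (n - r) powr \<beta> \<le> v r"
    proof -
      have "1 - x \<le> v r / real (n - r) powr \<beta>"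
        using M[of r n] \<open>0 < r\<close> \<open>r < n\<close> \<open>M + 1 \<le> n - r\<close> unfolding v_def by force
      then show ?thesis
        using \<open>r < n\<close> by (simp add: pos_le_divide_eq)
    qed
    have v1_nonneg: "0 \<le> v 1"
    proof -
      have "0 \<le> v r" 
        by (rule order_trans[OF mult_nonneg_nonneg vr]) (use x in simp_all)
      also have "v r \<le> v 1"
        unfolding v_def using fin card \<open>0 < r\<close> \<open>r < n\<close> by (intro var_desc_antimono) auto
      finally show ?thesis .
    qed
    have max_v: "max_var (\<Lambda> n) (\<sigma> n) \<le> v 1"
      unfolding v_def using fin[of n] card[of n] \<open>2 \<le> n\<close> by (intro max_var_le_var_desc_1) auto
    have max_nonneg: "0 \<le> max_var (\<Lambda> n) (\<sigma> n)"
      using fin[of n] card[of n] \<open>2 \<le> n\<close> by (intro max_var_nonneg) auto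
    have "(1 - \<epsilon>) * max_var (\<Lambda> n) (\<sigma> n) \<le> h x * max_var (\<Lambda> n) (\<sigma> n)"
      using x(1) max_nonneg by (intro mult_right_mono) simp_all
    also have "\<dots> \<le> h x * v 1"
      using max_v x by (intro mult_left_mono) (simp_all add: h_def)
    also have "\<dots> \<le> h x * ((1 + x) * real n powr \<beta>)"
      using v1 x by (intro mult_left_mono) (simp_all add: h_def)
    also have "\<dots> = (1 - x) * ((1 - 2 * x) * real n) powr \<beta>"
      using x by (simp add: h_def powr_mult)
    also have "\<dots> \<le> (1 - x) * real (n - r) powr \<beta>"
      using x nr \<open>0 < \<beta>\<close> by (intro mult_left_mono powr_mono2) simp_all
    also note vr
    finally show ?case by (simp add: v_def r_def)
  qed
  with x show thesis by (intro that[of x]) simp_all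
qed

text \<open>
The average of the first \<open>r n\<close> variances is at least the last of them, which is nearly the maximum. Since
\<open>n / r n\<close> stays bounded, its logarithm is negligible against \<open>ln (1 / \<gamma> n)\<close>.
\<close>

lemma max_risk_ge_max_var:
  fixes \<Lambda> :: "nat \<Rightarrow> 'i set" and \<sigma> :: "nat \<Rightarrow> 'i \<Rightarrow> real" and \<gamma> :: "nat \<Rightarrow> real"
  assumes fin: "\<And>n. finite (\<Lambda> n)" and card: "\<And>n. card (\<Lambda> n) = n"
    and \<sigma>: "\<And>n l. l \<in> \<Lambda> n \<Longrightarrow> \<sigma> n l > 0"
    and \<gamma>: "\<And>n. n \<ge> 1 \<Longrightarrow> 0 < \<gamma> n \<and> \<gamma> n < 1"
    and \<gamma>0: "\<gamma> \<longlonglongrightarrow> 0"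
    and n\<gamma>: "filterlim (\<lambda>n. real n * \<gamma> n) at_top sequentially"
    and growth: "poly_growth \<Lambda> \<sigma> \<beta>" "0 < \<beta>"
    and \<epsilon>: "0 < \<epsilon>" "\<epsilon> < 1"
  shows "\<forall>\<^sub>F n in sequentially. \<forall>fhat\<in>estimators (\<Lambda> n).
     ennreal ((1 - \<epsilon>) * (2 * max_var (\<Lambda> n) (\<sigma> n) * real n * \<gamma> n * ln (inverse (\<gamma> n))))
       \<le> max_risk (\<Lambda> n) (\<sigma> n) (\<gamma> n) fhat"
proof -
  define e where "e = \<epsilon> / 2"
  have e: "0 < e" "e < 1" using \<epsilon> by (simp_all add: e_def)
  obtain \<eta> where \<eta>: "0 < \<eta>" "\<eta> < 1" and flat: "\<forall>\<^sub>F n in sequentially.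
      (1 - e) * max_var (\<Lambda> n) (\<sigma> n) \<le> var_desc (\<Lambda> n) (\<sigma> n) (nat \<lceil>\<eta> * real n\<rceil>)"
    by (rule poly_growth_flat_top[OF fin card growth e(1)])
  define r where "r n = nat \<lceil>\<eta> * real n\<rceil>" for n
  have r: "1 \<le> r n \<and> r n \<le> n" if "n \<ge> 1" for n
  proof -
    have "0 < \<eta> * real n" "\<eta> * real n \<le> real n" using \<eta> that by simp_all
    then show ?thesis by (simp add: r_def nat_le_iff ceiling_le_iff le_nat_iff)
  qed
  have r_o: "(\<lambda>n. ln (real n / real (r n))) \<in> o(\<lambda>n. ln (inverse (\<gamma> n)))"
  proof (rule landau_o.smallI)
    fix b :: real assume b: "0 < b"
    have "filterlim (\<lambda>n. ln (inverse (\<gamma> n))) at_top sequentially"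
      by (rule ln_inverse_at_top[OF \<gamma>0]) (use \<gamma> in blast)
    then have "\<forall>\<^sub>F n in sequentially. ln (inverse \<eta>) / b \<le> ln (inverse (\<gamma> n))"
      by (auto simp: filterlim_at_top)
    then show "\<forall>\<^sub>F n in sequentially. norm (ln (real n / real (r n))) \<le> b * norm (ln (inverse (\<gamma> n)))"
      using eventually_ge_at_top[of 1]
    proof eventually_elim
      case (elim n)
      have "\<eta> * real n \<le> real (r n)" by (simp add: r_def real_nat_ceiling_ge)
      then have "real n / real (r n) \<le> inverse \<eta>"
        using r[OF elim(2)] \<eta> by (simp add: field_simps)
      moreover have "1 \<le> real n / real (r n)"
        using r[OF elim(2)] by simp
      ultimately have "0 \<le> ln (real n / real (r n))" "ln (real n / real (r n)) \<le> ln (inverse \<eta>)"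
        by (simp add: ln_ge_zero, intro ln_mono) simp_all
      moreover have "ln (inverse \<eta>) \<le> b * ln (inverse (\<gamma> n))"
        using elim(1) b by (simp add: pos_divide_le_eq mult.commute)
      moreover have "b * ln (inverse (\<gamma> n)) \<le> b * norm (ln (inverse (\<gamma> n)))"
        using b by (intro mult_left_mono) simp_all
      ultimately show ?case by simp
    qed
  qed
  have "\<forall>\<^sub>F n in sequentially. \<forall>fhat\<in>estimators (\<Lambda> n).
     ennreal ((1 - e) * (2 * real n * \<gamma> n * ln (inverse (\<gamma> n)) *
                   (1 / real (r n) * (\<Sum>i=1..r n. var_desc (\<Lambda> n) (\<sigma> n) i))))
       \<le> max_risk (\<Lambda> n) (\<sigma> n) (\<gamma> n) fhat"
    by (intro max_risk_ge_top_variances[where \<sigma> = \<sigma>] fin card \<sigma> \<gamma> \<gamma>0 n\<gamma> r r_o e)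
  then show ?thesis
    using flat eventually_ge_at_top[of 1]
  proof eventually_elim
    case (elim n)
    define V where "V = max_var (\<Lambda> n) (\<sigma> n)"
    define X where "X = 2 * real n * \<gamma> n * ln (inverse (\<gamma> n))"
    define S where "S = 1 / real (r n) * (\<Sum>i=1..r n. var_desc (\<Lambda> n) (\<sigma> n) i)"
    have X: "0 \<le> X"
      using \<gamma>[OF elim(3)] by (simp add: X_def one_le_inverse)
    have V: "0 \<le> V"
      unfolding V_def using fin[of n] card[of n] elim(3) by (intro max_var_nonneg) auto
    have "(1 - e) * V \<le> S"
    proof -
      have "(\<Sum>i=1..r n. (1 - e) * V) \<le> (\<Sum>i=1..r n. var_desc (\<Lambda> n) (\<sigma> n) i)"
      proof (intro sum_mono)
        fix i assume "i \<in> {1..r n}"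
        then have "var_desc (\<Lambda> n) (\<sigma> n) (r n) \<le> var_desc (\<Lambda> n) (\<sigma> n) i"
          using r[OF elim(3)] fin card by (intro var_desc_antimono) auto
        with elim(2) show "(1 - e) * V \<le> var_desc (\<Lambda> n) (\<sigma> n) i"
          by (simp add: V_def r_def)
      qed
      then show ?thesis
        using r[OF elim(3)] by (simp add: S_def pos_le_divide_eq mult.commute)
    qed
    have "(1 - \<epsilon>) * (X * V) \<le> ((1 - e) * (1 - e)) * (X * V)"
      using X V by (intro mult_right_mono) (simp_all add: e_def algebra_simps)
    also have "\<dots> = (1 - e) * (X * ((1 - e) * V))" by (simp add: mult_ac)
    also have "\<dots> \<le> (1 - e) * (X * S)"
      using e X \<open>(1 - e) * V \<le> S\<close> by (intro mult_left_mono) simp_all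
    finally have "ennreal ((1 - \<epsilon>) * (X * V)) \<le> ennreal ((1 - e) * (X * S))"
      by (rule ennreal_leI)
    moreover have "X * V = 2 * max_var (\<Lambda> n) (\<sigma> n) * real n * \<gamma> n * ln (inverse (\<gamma> n))"
      by (simp add: X_def V_def mult_ac)
    ultimately show ?case
      using elim(1) unfolding X_def S_def by (auto intro: order_trans)
  qed
qed

section \<open>The lower bounds\<close>

theorem theorem4p1:
  fixes \<Lambda> :: "nat \<Rightarrow> 'i set" and \<sigma> :: "nat \<Rightarrow> 'i \<Rightarrow> real" and \<gamma> :: "nat \<Rightarrow> real"
  assumes "\<And>n. finite (\<Lambda> n)" and "\<And>n. card (\<Lambda> n) = n"
    and "\<And>n l. l \<in> \<Lambda> n \<Longrightarrow> \<sigma> n l > 0"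
    and "\<And>n. n \<ge> 1 \<Longrightarrow> 0 < \<gamma> n \<and> \<gamma> n < 1"
    and "\<gamma> \<longlonglongrightarrow> 0"
    and "filterlim (\<lambda>n. real n * \<gamma> n) at_top sequentially"
  shows "(\<exists>c \<delta>. (\<forall>n. 0 < c n \<and> c n < 1) \<and> c \<longlonglongrightarrow> (0::real) \<and> \<delta> \<longlonglongrightarrow> (0::real) \<and>
            (\<forall>\<^sub>F n in sequentially. \<forall>fhat\<in>estimators (\<Lambda> n).
               max_risk (\<Lambda> n) (\<sigma> n) (\<gamma> n) fhat \<ge>
                 (SUP \<alpha>\<in>weight_set (\<Lambda> n) (real n * \<gamma> n) (c n).
                    ennreal (2 * (1 + \<delta> n) *
                      (\<Sum>l\<in>\<Lambda> n. (\<sigma> n l)\<^sup>2 * \<alpha> l * ln (inverse (\<alpha> l)))))))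
    \<and> (\<forall>r :: nat \<Rightarrow> nat.
         (\<forall>n\<ge>1. 1 \<le> r n \<and> r n \<le> n) \<and>
         (\<lambda>n. ln (real n / real (r n))) \<in> o(\<lambda>n. ln (inverse (\<gamma> n))) \<longrightarrow>
         (\<exists>\<delta>. \<delta> \<longlonglongrightarrow> (0::real) \<and>
            (\<forall>\<^sub>F n in sequentially. \<forall>fhat\<in>estimators (\<Lambda> n).
               max_risk (\<Lambda> n) (\<sigma> n) (\<gamma> n) fhat \<ge>
                 ennreal (2 * real n * \<gamma> n * ln (inverse (\<gamma> n)) * (1 + \<delta> n) *
                   (1 / real (r n) * (\<Sum>i=1..r n. var_desc (\<Lambda> n) (\<sigma> n) i))))))
    \<and> (\<forall>\<beta>>0. poly_growth \<Lambda> \<sigma> \<beta> \<longrightarrow>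
         (\<exists>\<delta>. \<delta> \<longlonglongrightarrow> (0::real) \<and>
            (\<forall>\<^sub>F n in sequentially. \<forall>fhat\<in>estimators (\<Lambda> n).
               max_risk (\<Lambda> n) (\<sigma> n) (\<gamma> n) fhat \<ge>
                 ennreal (2 * (1 + \<delta> n) * max_var (\<Lambda> n) (\<sigma> n) * real n * \<gamma> n *
                   ln (inverse (\<gamma> n))))))"
proof (intro conjI allI impI)
  show "\<exists>c \<delta>. (\<forall>n. 0 < c n \<and> c n < 1) \<and> c \<longlonglongrightarrow> (0::real) \<and> \<delta> \<longlonglongrightarrow> (0::real) \<and>
            (\<forall>\<^sub>F n in sequentially. \<forall>fhat\<in>estimators (\<Lambda> n).
               max_risk (\<Lambda> n) (\<sigma> n) (\<gamma> n) fhat \<ge>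
                 (SUP \<alpha>\<in>weight_set (\<Lambda> n) (real n * \<gamma> n) (c n).
                    ennreal (2 * (1 + \<delta> n) *
                      (\<Sum>l\<in>\<Lambda> n. (\<sigma> n l)\<^sup>2 * \<alpha> l * ln (inverse (\<alpha> l))))))"
    by (intro max_risk_ge_SUP_weight_set[where \<sigma> = \<sigma>] assms)
next
  fix r :: "nat \<Rightarrow> nat"
  assume r: "(\<forall>n\<ge>1. 1 \<le> r n \<and> r n \<le> n) \<and> (\<lambda>n. ln (real n / real (r n))) \<in> o(\<lambda>n. ln (inverse (\<gamma> n)))"
  let ?P = "\<lambda>\<epsilon> n. \<forall>fhat\<in>estimators (\<Lambda> n).
     ennreal ((1 - \<epsilon>) * (2 * real n * \<gamma> n * ln (inverse (\<gamma> n)) *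
                   (1 / real (r n) * (\<Sum>i=1..r n. var_desc (\<Lambda> n) (\<sigma> n) i))))
       \<le> max_risk (\<Lambda> n) (\<sigma> n) (\<gamma> n) fhat"
  have "\<exists>\<delta>. \<delta> \<longlonglongrightarrow> 0 \<and> (\<forall>\<^sub>F n in sequentially. ?P (- \<delta> n) n)"
    by (rule vanishing_sequence[of ?P], rule max_risk_ge_top_variances[where \<sigma> = \<sigma>])
      (use assms r in auto)
  then
  show "\<exists>\<delta>. \<delta> \<longlonglongrightarrow> (0::real) \<and>
            (\<forall>\<^sub>F n in sequentially. \<forall>fhat\<in>estimators (\<Lambda> n).
               max_risk (\<Lambda> n) (\<sigma> n) (\<gamma> n) fhat \<ge>
                 ennreal (2 * real n * \<gamma> n * ln (inverse (\<gamma> n)) * (1 + \<delta> n) *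
                   (1 / real (r n) * (\<Sum>i=1..r n. var_desc (\<Lambda> n) (\<sigma> n) i))))"
    by (simp add: mult_ac)
next
  fix \<beta> :: real assume growth: "0 < \<beta>" "poly_growth \<Lambda> \<sigma> \<beta>"
  let ?P = "\<lambda>\<epsilon> n. \<forall>fhat\<in>estimators (\<Lambda> n).
     ennreal ((1 - \<epsilon>) * (2 * max_var (\<Lambda> n) (\<sigma> n) * real n * \<gamma> n * ln (inverse (\<gamma> n))))
       \<le> max_risk (\<Lambda> n) (\<sigma> n) (\<gamma> n) fhat"
  have "\<exists>\<delta>. \<delta> \<longlonglongrightarrow> 0 \<and> (\<forall>\<^sub>F n in sequentially. ?P (- \<delta> n) n)"
    by (rule vanishing_sequence[of ?P], rule max_risk_ge_max_var[where \<sigma> = \<sigma> and \<beta> = \<beta>])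
      (use assms growth in auto)
  then
  show "\<exists>\<delta>. \<delta> \<longlonglongrightarrow> (0::real) \<and>
            (\<forall>\<^sub>F n in sequentially. \<forall>fhat\<in>estimators (\<Lambda> n).
               max_risk (\<Lambda> n) (\<sigma> n) (\<gamma> n) fhat \<ge>
                 ennreal (2 * (1 + \<delta> n) * max_var (\<Lambda> n) (\<sigma> n) * real n * \<gamma> n *
                   ln (inverse (\<gamma> n))))"
    by (simp add: algebra_simps)
qed

end
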